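(* Fix $T>0$ and let $$\Omega=\{q=(x,y)\in H^1([0,T],\mathbb R^2): y(0)=0,\ y(T)=0,\ x(0)\ge 0,\ x(T)\le 0\},$$ $$\mathcal A(q)=\int_0^T\Big(\frac12|\dot q(t)|^2+\frac{1}{|q(t)|}+x(t)\Big)\,dt .$$ Then every global minimizer of $\mathcal A$ on $\Omega$ is half of a collision–ejection orbit of the planar Stark problem $\ddot x=-x/r^3+1$, $\ddot y=-y/r^3$ ($r=\sqrt{x^2+y^2}$) lying on the negative $x$-axis, i.e. the corresponding collision–ejection orbit has period $2T$.
   Context: A collision–ejection orbit on the negative $x$-axis is a solution moving on $\{(x,0):x<0\}$ which collides with the origin and (after regularization) is ejected back along the same half-line; it is periodic. *)

theory Defs
  imports "HOL-Analysis.Analysis"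
begin

text \<open>Paths in the plane are functions real => real * real; the norm on real * real is
  the Euclidean norm. Only the values on [0,T] matter for the variational problem.\<close>

text \<open>v is a (Lebesgue) weak derivative of q on [0,T] with v in L^2: q is the
  absolutely continuous representative of an H^1 function with derivative v.\<close>
definition H1_deriv :: "real \<Rightarrow> (real \<Rightarrow> real \<times> real) \<Rightarrow> (real \<Rightarrow> real \<times> real) \<Rightarrow> bool" where
  "H1_deriv T q v \<longleftrightarrow>
     set_integrable lborel {0..T} v \<and>
     set_integrable lborel {0..T} (\<lambda>t. (norm (v t))\<^sup>2) \<and>
     (\<forall>t\<in>{0..T}. q t = q 0 + (LINT s:{0..t}|lborel. v s))"

definition H1 :: "real \<Rightarrow> (real \<Rightarrow> real \<times> real) \<Rightarrow> bool" where
  "H1 T q \<longleftrightarrow> (\<exists>v. H1_deriv T q v)"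

definition Omega :: "real \<Rightarrow> (real \<Rightarrow> real \<times> real) set" where
  "Omega T = {q. H1 T q \<and> snd (q 0) = 0 \<and> snd (q T) = 0 \<and> fst (q 0) \<ge> 0 \<and> fst (q T) \<le> 0}"

text \<open>Action with a given weak derivative; the Newtonian term 1/|q| is +infinity at collisions,
  so the action takes values in (-infinity, +infinity].\<close>
definition action_with :: "real \<Rightarrow> (real \<Rightarrow> real \<times> real) \<Rightarrow> (real \<Rightarrow> real \<times> real) \<Rightarrow> ereal" where
  "action_with T q v =
     enn2ereal (\<integral>\<^sup>+ t\<in>{0..T}. (ennreal ((norm (v t))\<^sup>2 / 2)
         + (if q t = 0 then \<infinity> else ennreal (1 / norm (q t)))) \<partial>lborel)
     + ereal (LINT t:{0..T}|lborel. fst (q t))"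

definition action :: "real \<Rightarrow> (real \<Rightarrow> real \<times> real) \<Rightarrow> ereal" where
  "action T q = action_with T q (SOME v. H1_deriv T q v)"

definition global_minimizer :: "real \<Rightarrow> (real \<Rightarrow> real \<times> real) \<Rightarrow> bool" where
  "global_minimizer T q \<longleftrightarrow> q \<in> Omega T \<and> (\<forall>q'\<in>Omega T. action T q \<le> action T q')"

definition stark_field :: "real \<times> real \<Rightarrow> real \<times> real" where
  "stark_field p = (- fst p / norm p ^ 3 + 1, - snd p / norm p ^ 3)"

end

theory Submission
  imports Defs
begin

text \<open>
  In parabolic coordinates \<open>\<xi>\<^sup>2 = (r + x)/2\<close>, \<open>\<eta>\<^sup>2 = (r - x)/2\<close> and Levi-Civita time \<open>ds = dt/r\<close>
  the action separates into the integral of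
  \<open>2 (\<xi>'\<^sup>2 + \<eta>'\<^sup>2) + 1 + \<xi>\<^sup>4 - \<eta>\<^sup>4\<close> over \<open>[0, S]\<close>, with the constraint that \<open>\<xi>\<^sup>2 + \<eta>\<^sup>2\<close> has
  integral \<open>T\<close> and the boundary conditions \<open>\<eta>(0) = 0 = \<xi>(S)\<close>.
  Reversing \<open>\<xi>\<close> in time and putting \<open>\<eta>\<^sub>1(s)\<^sup>2 = \<eta>(s)\<^sup>2 + \<xi>(S - s)\<^sup>2\<close>, \<open>\<xi>\<^sub>1 = 0\<close> yields a path on
  the negative axis which satisfies the same constraints, has no larger kinetic term, and gains
  at least twice the integral of \<open>\<xi>\<^sup>4\<close>. Hence \<open>\<xi> = 0\<close> for a minimizer.
  To avoid a chain rule for \<open>H\<^sup>1\<close> paths through collisions, the symmetrized path is replaced by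
  interpolants that are linear in \<open>s\<close>; in the time \<open>t\<close> these are powers with exponent \<open>2/3\<close> of
  piecewise linear functions.

  On the axis the distance \<open>r\<close> to the origin is nondecreasing, hence positive after time 0, and
  varying \<open>r\<close> by ramp functions, with the end at time \<open>T\<close> left free, gives
  \<open>r'(t) = \<integral>\<^sub>t\<^sup>T (1/r\<^sup>2 + 1)\<close>. In particular \<open>r'(T) = 0\<close>, so the even \<open>2T\<close>-periodic extension is
  a solution away from collisions.
\<close>

section \<open>Weak derivatives and the value of the action\<close>

text \<open>Reversing \<xi> makes both coordinates vanish at s = 0, so that
  \<open>\<eta>\<^sub>1\<close> starts at the collision. As the length of the vector (\<eta>(s),
  \<xi>(S - s)) it has increments no larger than those of the vector, which bounds the kinetic term;
  its fourth power is at least the sum of the two fourth powers, so the term in \<xi> turns from a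
  cost into a profit. The linear interpolants keep the Levi-Civita duration S but miss the time
  constraint slightly. Multiplying them by a constant repairs this: if the time scales by c, the
  kinetic term scales by c and the quartic term by the square of c, and c tends to 1 as the grid is
  refined. Only numbers pass to the limit, not paths. On the axis the force is singular at the
  collision. The ramps therefore start at a time a > 0, after which monotonicity keeps r above r(a);
  they remain at height 1 up to T, which yields the free-end condition.\<close>

lemma AE_zero_if_integral_atMost_zero:
  fixes f :: "real \<Rightarrow> 'a::{banach, second_countable_topology}"
  assumes f: "integrable lborel f"
    and zero: "\<And>a. (LINT x:{..a}|lborel. f x) = 0"
  shows "AE x in lborel. f x = 0"
proof (rule sigma_finite_measure.density_zero[OF lborel.sigma_finite_measure_axioms f])
  have sub: "set_integrable lborel A f" if "A \<in> sets lborel" for A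
    unfolding set_integrable_def using f that by (intro integrable_mult_indicator) auto
  have UN: "(\<Union>n. {..real n}) = UNIV"
    by (auto simp: real_arch_simple)
  have "(\<lambda>n. LINT x:{..real n}|lborel. f x) \<longlonglongrightarrow> (LINT x:(\<Union>n. {..real n})|lborel. f x)"
    by (intro set_integral_cont_up sub) (auto simp: incseq_def)
  then have tot: "integral\<^sup>L lborel f = 0"
    unfolding UN zero by (simp add: LIMSEQ_const_iff set_lebesgue_integral_def)
  fix A :: "real set" assume "A \<in> sets lborel"
  then have "A \<in> sigma_sets UNIV (range (\<lambda>a::real. {..a}))"
    by (simp add: borel_eq_atMost)
  \<comment> \<open>The half-lines generate the Borel sets and are stable under intersection, so the
    vanishing of the integral spreads from them to all Borel sets; \<open>tot\<close> serves the
    complements.\<close>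
  have "Int_stable (range (\<lambda>a::real. {..a}))"
    unfolding Int_stable_def by (auto simp: image_iff)
  moreover have "range (\<lambda>a::real. {..a}) \<subseteq> Pow UNIV" by simp
  ultimately show "(LINT x:A|lborel. f x) = 0"
    using \<open>A \<in> sigma_sets _ _\<close>
  proof (induction rule: sigma_sets_induct_disjoint)
    case (basic A)
    then show ?case using zero by auto
  next
    case (compl A)
    then have A: "A \<in> sets lborel" by (simp add: borel_eq_atMost)
    then have "(LINT x:A \<union> (UNIV - A)|lborel. f x) = (LINT x:A|lborel. f x) + (LINT x:UNIV - A|lborel. f x)"
      by (intro set_integral_Un sub) auto
    then show ?case using compl tot by (simp add: set_lebesgue_integral_def)
  next
    case (union A)
    then have "A i \<in> sets lborel" for i by (auto simp: borel_eq_atMost)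
    then have "(LINT x:(\<Union>i. A i)|lborel. f x) = (\<Sum>i. LINT x:A i|lborel. f x)"
      using union(1) by (intro lebesgue_integral_countable_add sub) (auto simp: disjoint_family_on_def)
    then show ?case using union by simp
  qed (auto simp: set_lebesgue_integral_def)
qed

text \<open>Makes \<open>action\<close> independent of the derivative chosen by SOME: two weak
  derivatives have equal integrals over all initial intervals.\<close>

lemma H1_deriv_unique:
  assumes "H1_deriv T q v" "H1_deriv T q w" and T: "T > 0"
  shows "AE t in lborel. t \<in> {0..T} \<longrightarrow> v t = w t"
proof -
  define f where "f = (\<lambda>t. indicator {0..T} t *\<^sub>R v t - indicator {0..T} t *\<^sub>R w t)"
  have v: "set_integrable lborel {0..T} v" and w: "set_integrable lborel {0..T} w"
    using assms unfolding H1_deriv_def by blast+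
  have f: "integrable lborel f"
    unfolding f_def using v w by (auto simp: set_integrable_def)
  have "(LINT x:{..a}|lborel. f x) = 0" for a
  proof (cases "a < 0")
    case True
    then have "(\<lambda>x. indicator {..a} x *\<^sub>R f x) = (\<lambda>x. 0)"
      by (auto simp: f_def indicator_def)
    then show ?thesis by (simp add: set_lebesgue_integral_def)
  next
    case False
    define b where "b = min a T"
    have b: "b \<in> {0..T}" using False T by (auto simp: b_def)
    have *: "(\<lambda>x. indicator {..a} x *\<^sub>R f x) = (\<lambda>x. indicator {0..b} x *\<^sub>R v x - indicator {0..b} x *\<^sub>R w x)"
      by (auto simp: f_def indicator_def b_def)
    have "set_integrable lborel {0..b} v" "set_integrable lborel {0..b} w"
      using b v w by (auto intro: set_integrable_subset)
    then have "(LINT x:{..a}|lborel. f x) = (LINT x:{0..b}|lborel. v x) - (LINT x:{0..b}|lborel. w x)"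
      unfolding set_lebesgue_integral_def * by (intro Bochner_Integration.integral_diff) (auto simp: set_integrable_def)
    moreover have "q b = q 0 + (LINT x:{0..b}|lborel. v x)" "q b = q 0 + (LINT x:{0..b}|lborel. w x)"
      using assms b unfolding H1_deriv_def by blast+
    ultimately show ?thesis by (metis add_left_cancel right_minus_eq)
  qed
  from AE_zero_if_integral_atMost_zero[OF f this] show ?thesis
    by eventually_elim (auto simp: f_def)
qed

lemma action_eq_action_with:
  assumes "H1_deriv T q v" and "T > 0"
  shows "action T q = action_with T q v"
proof -
  have "H1_deriv T q (SOME v. H1_deriv T q v)"
    by (rule someI[of "H1_deriv T q", OF assms(1)])
  from H1_deriv_unique[OF this assms(1,2)]
  have "AE t in lborel. t \<in> {0..T} \<longrightarrow> (SOME v. H1_deriv T q v) t = v t" .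
  then have "AE t in lborel. (ennreal ((norm ((SOME v. H1_deriv T q v) t))\<^sup>2 / 2)
         + (if q t = 0 then \<infinity> else ennreal (1 / norm (q t)))) * indicator {0..T} t =
       (ennreal ((norm (v t))\<^sup>2 / 2)
         + (if q t = 0 then \<infinity> else ennreal (1 / norm (q t)))) * indicator {0..T} t"
    by eventually_elim (simp add: indicator_def)
  then show ?thesis unfolding action_def action_with_def
    by (simp only: nn_integral_cong_AE)
qed

lemma H1_deriv_integral:
  assumes "H1_deriv T q v" and "t \<in> {0..T}"
  shows "q t = q 0 + integral {0..t} v"
proof -
  have "set_integrable lborel {0..T} v"
    using assms unfolding H1_deriv_def by blast
  then have "set_integrable lborel {0..t} v"
    by (rule set_integrable_subset) (use assms(2) in auto)
  moreover have "q t = q 0 + (LINT x:{0..t}|lborel. v x)"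
    using assms unfolding H1_deriv_def by blast
  ultimately show ?thesis
    by (simp only: set_borel_integral_eq_integral)
qed

lemma H1_deriv_integrable:
  assumes "H1_deriv T q v"
  shows "v integrable_on {0..T}" "(\<lambda>t. (norm (v t))\<^sup>2) integrable_on {0..T}"
  using assms unfolding H1_deriv_def by (blast intro: set_borel_integral_eq_integral(1))+

lemma H1_deriv_continuous:
  assumes "H1_deriv T q v"
  shows "continuous_on {0..T} q"
proof -
  have "continuous_on {0..T} (\<lambda>t. q 0 + integral {0..t} v)"
    by (intro continuous_intros indefinite_integral_continuous_1 H1_deriv_integrable[OF assms])
  then show ?thesis
    by (rule continuous_on_eq) (rule H1_deriv_integral[OF assms, symmetric])
qed

lemma action_finite_imp_integrable:
  assumes v: "H1_deriv T q v" and fin: "action_with T q v < \<infinity>"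
  shows "set_integrable lborel {0..T} (\<lambda>t. 1 / norm (q t))"
    and "AE t in lborel. t \<in> {0..T} \<longrightarrow> q t \<noteq> 0"
proof -
  define g :: "real \<Rightarrow> ennreal" where "g t = (if q t = 0 then \<infinity> else ennreal (1 / norm (q t)))" for t
  \<comment> \<open>Outside {0..T} nothing is known about q; cutting it off gives a function that is
    measurable on the whole line.\<close>
  define Q where "Q = (\<lambda>t. indicator {0..T} t *\<^sub>R q t)"
  have Q[measurable]: "Q \<in> borel_measurable borel"
    unfolding Q_def using H1_deriv_continuous[OF v]
    by (intro borel_measurable_continuous_on_indicator) auto
  have gQ: "(\<lambda>t. g t * indicator {0..T} t) = (\<lambda>t. (if Q t = 0 then \<infinity> else ennreal (1 / norm (Q t))) * indicator {0..T} t)"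
    by (auto simp: g_def Q_def indicator_def)
  have gm[measurable]: "(\<lambda>t. g t * indicator {0..T} t) \<in> borel_measurable lborel"
    unfolding gQ by measurable
  have "(\<integral>\<^sup>+t. g t * indicator {0..T} t \<partial>lborel) \<le>
      (\<integral>\<^sup>+ t\<in>{0..T}. (ennreal ((norm (v t))\<^sup>2 / 2) + g t) \<partial>lborel)"
    by (intro nn_integral_mono) (auto simp: indicator_def)
  also have "\<dots> < \<infinity>"
    using fin unfolding action_with_def g_def[symmetric]
    by (auto simp: less_top)
  finally have I: "(\<integral>\<^sup>+t. g t * indicator {0..T} t \<partial>lborel) < \<infinity>" .
  from finite_nn_integral_imp_ae_finite[OF gm I]
  show "AE t in lborel. t \<in> {0..T} \<longrightarrow> q t \<noteq> 0"
    by eventually_elim (auto simp: g_def)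
  show "set_integrable lborel {0..T} (\<lambda>t. 1 / norm (q t))"
    unfolding set_integrable_def
  proof (rule integrableI_bounded)
    have "(\<lambda>x. indicat_real {0..T} x *\<^sub>R (1 / norm (q x))) = (\<lambda>x. 1 / norm (Q x))"
      by (auto simp: Q_def indicator_def)
    then show "(\<lambda>x. indicat_real {0..T} x *\<^sub>R (1 / norm (q x))) \<in> borel_measurable lborel"
      by simp
    have "(\<integral>\<^sup>+ x. ennreal (norm (indicat_real {0..T} x *\<^sub>R (1 / norm (q x)))) \<partial>lborel)
        \<le> (\<integral>\<^sup>+t. g t * indicator {0..T} t \<partial>lborel)"
      by (intro nn_integral_mono) (auto simp: g_def indicator_def)
    with I show "(\<integral>\<^sup>+ x. ennreal (norm (indicat_real {0..T} x *\<^sub>R (1 / norm (q x)))) \<partial>lborel) < \<infinity>"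
      by order
  qed
qed

text \<open>The infinite value at collisions and the default 1 / 0 = 0 differ only on a null set, so
  the extended action may be replaced by real gauge integrals.\<close>

lemma action_with_eq_integral:
  assumes v: "H1_deriv T q v"
    and int: "set_integrable lborel {0..T} (\<lambda>t. 1 / norm (q t))"
    and ae: "AE t in lborel. t \<in> {0..T} \<longrightarrow> q t \<noteq> 0"
  shows "action_with T q v = ereal (integral {0..T} (\<lambda>t. (norm (v t))\<^sup>2 / 2)
           + integral {0..T} (\<lambda>t. 1 / norm (q t)) + integral {0..T} (\<lambda>t. fst (q t)))"
proof -
  have i1: "(\<lambda>t. (norm (v t))\<^sup>2 / 2) integrable_on {0..T}"
    using H1_deriv_integrable(2)[OF v] by (rule integrable_on_divide)
  have i2: "(\<lambda>t. 1 / norm (q t)) integrable_on {0..T}"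
    using int by (rule set_borel_integral_eq_integral)
  have "set_integrable lborel {0..T} (\<lambda>t. fst (q t))"
    by (intro borel_integrable_atLeastAtMost' continuous_intros H1_deriv_continuous[OF v])
  note i3 = set_borel_integral_eq_integral(2)[OF this]
  let ?f = "\<lambda>t. (norm (v t))\<^sup>2 / 2 + 1 / norm (q t)"
  have "(\<integral>\<^sup>+ t\<in>{0..T}. (ennreal ((norm (v t))\<^sup>2 / 2)
         + (if q t = 0 then \<infinity> else ennreal (1 / norm (q t)))) \<partial>lborel)
       = (\<integral>\<^sup>+ t. ennreal (?f t) * indicator {0..T} t \<partial>lborel)"
    by (rule nn_integral_cong_AE, use ae in eventually_elim) (simp add: indicator_def)
  also have "\<dots> = ennreal (integral {0..T} ?f)"
    by (intro nn_integral_has_integral_lebesgue' integrable_integral integrable_add i1 i2) auto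
  finally have *: "enn2ereal (\<integral>\<^sup>+ t\<in>{0..T}. (ennreal ((norm (v t))\<^sup>2 / 2)
         + (if q t = 0 then \<infinity> else ennreal (1 / norm (q t)))) \<partial>lborel) = ereal (integral {0..T} ?f)"
    by (simp add: enn2ereal_ennreal integral_nonneg integrable_add i1 i2)
  show ?thesis unfolding action_with_def * i3 by (simp add: integral_add i1 i2)
qed

section \<open>Paths on the negative axis\<close>

text \<open>The path is (-r, 0), starting at the collision because the integral formula forces r 0 =
  0. Hence also the minus sign of the last term in \<open>radial_action\<close>.\<close>

definition radial :: "real \<Rightarrow> (real \<Rightarrow> real) \<Rightarrow> (real \<Rightarrow> real) \<Rightarrow> bool" where
  "radial T r v \<longleftrightarrow>
     set_integrable lborel {0..T} v \<and>
     set_integrable lborel {0..T} (\<lambda>t. (v t)\<^sup>2) \<and>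
     set_integrable lborel {0..T} (\<lambda>t. 1 / r t) \<and>
     (\<forall>t\<in>{0..T}. r t = integral {0..t} v) \<and>
     (\<forall>t\<in>{0..T}. 0 \<le> r t) \<and>
     (AE t in lborel. t \<in> {0..T} \<longrightarrow> r t \<noteq> 0)"

definition radial_action :: "real \<Rightarrow> (real \<Rightarrow> real) \<Rightarrow> (real \<Rightarrow> real) \<Rightarrow> real" where
  "radial_action T r v = integral {0..T} (\<lambda>t. (v t)\<^sup>2 / 2)
     + integral {0..T} (\<lambda>t. 1 / r t) - integral {0..T} r"

lemma radialD:
  assumes "radial T r v"
  shows "set_integrable lborel {0..T} v" "set_integrable lborel {0..T} (\<lambda>t. (v t)\<^sup>2)"
    and "set_integrable lborel {0..T} (\<lambda>t. 1 / r t)"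
    and "t \<in> {0..T} \<Longrightarrow> r t = integral {0..t} v" "t \<in> {0..T} \<Longrightarrow> 0 \<le> r t"
    and "AE t in lborel. t \<in> {0..T} \<longrightarrow> r t \<noteq> 0"
  using assms unfolding radial_def by blast+

lemma radial_H1_deriv:
  assumes r: "radial T r v"
  shows "H1_deriv T (\<lambda>t. (- r t, 0)) (\<lambda>t. (- v t, 0))"
proof -
  have bl: "bounded_linear (\<lambda>x::real. (- x, 0::real))"
    by (intro bounded_linear_Pair bounded_linear_minus bounded_linear_ident bounded_linear_zero)
  have v: "set_integrable lborel {0..T} v" "set_integrable lborel {0..T} (\<lambda>t. (v t)\<^sup>2)"
    by (rule radialD[OF r])+
  have *: "indicator A t *\<^sub>R (- v t, 0::real) = (- (indicator A t *\<^sub>R v t), 0)" for A t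
    by simp
  have "set_integrable lborel {0..T} (\<lambda>t. (- v t, 0::real))"
    unfolding set_integrable_def * using v(1)[unfolded set_integrable_def]
    by (rule integrable_bounded_linear[OF bl])
  moreover have "(LINT s:{0..t}|lborel. (- v s, 0::real)) = (- r t, 0)" if t: "t \<in> {0..T}" for t
  proof -
    have vt: "set_integrable lborel {0..t} v"
      using v(1) by (rule set_integrable_subset) (use t in auto)
    have "(LINT s:{0..t}|lborel. (- v s, 0::real)) = (- (LINT s:{0..t}|lborel. v s), 0)"
      unfolding set_lebesgue_integral_def *
      by (rule integral_bounded_linear[OF bl vt[unfolded set_integrable_def]])
    then show ?thesis
      using radialD(4)[OF r t] by (simp add: set_borel_integral_eq_integral(2)[OF vt])
  qed
  moreover have "r 0 = 0" if "0 \<le> T"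
    using radialD(4)[OF r, of 0] that by simp
  ultimately show ?thesis
    using v(2) unfolding H1_deriv_def by (auto simp: norm_Pair zero_prod_def)
qed

lemma action_radial:
  assumes "radial T r v" and "T > 0"
  shows "action T (\<lambda>t. (- r t, 0)) = ereal (radial_action T r v)"
proof -
  have abs_r: "\<bar>r t\<bar> = r t" if "t \<in> {0..T}" for t
    using radialD(5)[OF assms(1) that] by simp
  have "action T (\<lambda>t. (- r t, 0)) = action_with T (\<lambda>t. (- r t, 0)) (\<lambda>t. (- v t, 0))"
    by (rule action_eq_action_with[OF radial_H1_deriv[OF assms(1)] assms(2)])
  also have "\<dots> = ereal (integral {0..T} (\<lambda>t. (norm (- v t, 0::real))\<^sup>2 / 2)
     + integral {0..T} (\<lambda>t. 1 / norm (- r t, 0::real)) + integral {0..T} (\<lambda>t. fst (- r t, 0::real)))"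
  proof (rule action_with_eq_integral[OF radial_H1_deriv[OF assms(1)]])
    show "set_integrable lborel {0..T} (\<lambda>t. 1 / norm (- r t, 0::real))"
      using radialD(3)[OF assms(1)]
      by (subst set_integrable_cong[OF refl refl]) (simp_all add: norm_Pair abs_r)
    show "AE t in lborel. t \<in> {0..T} \<longrightarrow> (- r t, 0::real) \<noteq> 0"
      using radialD(6)[OF assms(1)] by eventually_elim (auto simp: zero_prod_def)
  qed
  also have "integral {0..T} (\<lambda>t. 1 / norm (- r t, 0::real)) = integral {0..T} (\<lambda>t. 1 / r t)"
    by (intro integral_cong) (simp add: norm_Pair abs_r)
  finally show ?thesis by (simp add: radial_action_def norm_Pair)
qed

lemma radial_mem_Omega:
  assumes "radial T r v" and "T > 0"
  shows "(\<lambda>t. (- r t, 0)) \<in> Omega T"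
proof -
  have "r 0 = 0" "r T \<ge> 0" using radialD(4,5)[OF assms(1)] assms(2) by auto
  then show ?thesis
    using radial_H1_deriv[OF assms(1)] by (auto simp: Omega_def H1_def)
qed

lemma minimizer_le_radial:
  assumes "global_minimizer T q" "radial T r v" "T > 0"
  shows "action T q \<le> ereal (radial_action T r v)"
  using assms radial_mem_Omega[OF assms(2,3)] action_radial[OF assms(2,3)]
  by (metis global_minimizer_def)

lemma action_cong:
  assumes v: "H1_deriv T q v" and eq: "\<And>t. t \<in> {0..T} \<Longrightarrow> q t = q' t" and T: "T > 0"
  shows "action T q = action T q'"
proof -
  have "q 0 = q' 0" using eq T by simp
  then have v': "H1_deriv T q' v"
    using v eq unfolding H1_deriv_def by metis
  have "action_with T q v = action_with T q' v"
    unfolding action_with_def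
    by (intro arg_cong2[where f="(+)"] arg_cong[where f=enn2ereal] arg_cong[where f=ereal]
        nn_integral_cong set_lebesgue_integral_cong) (auto simp: eq indicator_def)
  then show ?thesis
    using action_eq_action_with[OF v T] action_eq_action_with[OF v' T] by simp
qed

text \<open>Converse of \<open>action_radial\<close>: it lets a planar minimizer already known to
  lie on the axis be treated as a one-dimensional one.\<close>

lemma radial_of_axis_path:
  assumes v: "H1_deriv T q v" and T: "T > 0" and fin: "action T q < \<infinity>"
    and axis: "\<And>t. t \<in> {0..T} \<Longrightarrow> snd (q t) = 0 \<and> fst (q t) \<le> 0" and q0: "q 0 = 0"
  shows "radial T (\<lambda>t. - fst (q t)) (\<lambda>t. - fst (v t))"
    and "action T q = ereal (radial_action T (\<lambda>t. - fst (q t)) (\<lambda>t. - fst (v t)))"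
proof -
  have eq: "q t = (- (- fst (q t)), 0)" if "t \<in> {0..T}" for t
    using axis[OF that] by (simp add: prod_eq_iff)
  have norm: "norm (q t) = - fst (q t)" if "t \<in> {0..T}" for t
    using axis[OF that] by (cases "q t") (simp add: norm_Pair)
  have fin': "action_with T q v < \<infinity>"
    using fin action_eq_action_with[OF v T] by simp
  have bl: "bounded_linear (\<lambda>x::real \<times> real. - fst x)"
    by (intro bounded_linear_minus bounded_linear_fst)
  have iv: "set_integrable lborel {0..T} v" and iv2: "set_integrable lborel {0..T} (\<lambda>t. (norm (v t))\<^sup>2)"
    using v unfolding H1_deriv_def by blast+
  have *: "indicator A t *\<^sub>R (- fst (v t)) = - fst (indicator A t *\<^sub>R v t)" for A t
    by simp
  have int: "set_integrable lborel {0..T} (\<lambda>t. - fst (v t))"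
    unfolding set_integrable_def * using iv[unfolded set_integrable_def]
    by (rule integrable_bounded_linear[OF bl])
  have meas: "(\<lambda>t. indicator {0..T} t *\<^sub>R (- fst (v t))) \<in> borel_measurable lborel"
    using int by (auto simp: set_integrable_def)
  have int2: "set_integrable lborel {0..T} (\<lambda>t. (- fst (v t))\<^sup>2)"
    unfolding set_integrable_def
  proof (rule Bochner_Integration.integrable_bound[OF iv2[unfolded set_integrable_def]])
    have "(\<lambda>t. (indicator {0..T} t *\<^sub>R (- fst (v t)))\<^sup>2) \<in> borel_measurable lborel"
      using meas by (rule borel_measurable_power)
    then show "(\<lambda>t. indicat_real {0..T} t *\<^sub>R (- fst (v t))\<^sup>2) \<in> borel_measurable lborel"
      by (rule measurable_cong[THEN iffD1, rotated]) (auto simp: indicator_def)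
    show "AE x in lborel. norm (indicat_real {0..T} x *\<^sub>R (- fst (v x))\<^sup>2)
        \<le> norm (indicat_real {0..T} x *\<^sub>R (norm (v x))\<^sup>2)"
      by (rule AE_I2) (auto simp: indicator_def norm_prod_def)
  qed
  have "- fst (q t) = integral {0..t} (\<lambda>t. - fst (v t))" if t: "t \<in> {0..T}" for t
  proof -
    have "v integrable_on {0..t}"
      using H1_deriv_integrable(1)[OF v] by (rule integrable_on_subinterval) (use t in auto)
    then have "integral {0..t} (\<lambda>t. - fst (v t)) = - fst (integral {0..t} v)"
      using integral_linear[OF _ bl, of v "{0..t}"] by (simp add: o_def)
    moreover have "q t = integral {0..t} v"
      using H1_deriv_integral[OF v t] q0 by simp
    ultimately show ?thesis by simp
  qed
  moreover have "set_integrable lborel {0..T} (\<lambda>t. 1 / (- fst (q t)))"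
    using action_finite_imp_integrable(1)[OF v fin']
    by (subst set_integrable_cong[OF refl refl]) (simp_all add: norm)
  moreover have "AE t in lborel. t \<in> {0..T} \<longrightarrow> - fst (q t) \<noteq> 0"
    using action_finite_imp_integrable(2)[OF v fin']
    by eventually_elim (use axis in \<open>auto simp: prod_eq_iff\<close>)
  ultimately show rad: "radial T (\<lambda>t. - fst (q t)) (\<lambda>t. - fst (v t))"
    using int int2 axis by (auto simp: radial_def)
  show "action T q = ereal (radial_action T (\<lambda>t. - fst (q t)) (\<lambda>t. - fst (v t)))"
    using action_cong[OF v eq T] action_radial[OF rad T] by simp
qed

section \<open>Polygonal competitors\<close>

lemma set_integrable_lborel_nonneg:
  fixes f :: "real \<Rightarrow> real"
  assumes [measurable]: "f \<in> borel_measurable borel" "A \<in> sets borel"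
    and nonneg: "\<And>t. t \<in> A \<Longrightarrow> 0 \<le> f t" and f: "f integrable_on A"
  shows "set_integrable lborel A f"
  unfolding set_integrable_def
proof (rule integrableI_bounded)
  have "(\<integral>\<^sup>+ t. ennreal (norm (indicat_real A t *\<^sub>R f t)) \<partial>lborel) = (\<integral>\<^sup>+ t. ennreal (f t) * indicator A t \<partial>lborel)"
    by (intro nn_integral_cong) (auto simp: indicator_def nonneg)
  also have "\<dots> = ennreal (integral A f)"
    using nonneg f by (intro nn_integral_has_integral_lebesgue') auto
  finally show "(\<integral>\<^sup>+ t. ennreal (norm (indicat_real A t *\<^sub>R f t)) \<partial>lborel) < \<infinity>"
    by simp
qed simp

text \<open>The distance is \<open>w powr (2/3)\<close> with \<open>w\<close> linear in \<open>t\<close>: its square root runs linearly from \<open>\<alpha>\<close> to \<open>\<beta>\<close> in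
  Levi-Civita time \<open>D\<close>, which explains the duration \<open>\<tau>\<close>.\<close>

lemma kepler_arc:
  fixes \<alpha> \<beta> D A :: real
  assumes \<alpha>: "\<alpha> \<ge> 0" and \<beta>: "\<beta> > 0" and D: "D > 0"
  defines "\<tau> \<equiv> D * (\<alpha>\<^sup>2 + \<alpha> * \<beta> + \<beta>\<^sup>2) / 3"
  obtains r v :: "real \<Rightarrow> real" where
    "r \<in> borel_measurable borel" "v \<in> borel_measurable borel"
    "\<tau> > 0" "r A = \<alpha>\<^sup>2" "r (A + \<tau>) = \<beta>\<^sup>2"
    "\<And>t. t \<in> {A<..A + \<tau>} \<Longrightarrow> r t > 0"
    "\<And>t. t \<in> {A..A + \<tau>} \<Longrightarrow> r t \<ge> (min \<alpha> \<beta>)\<^sup>2"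
    "continuous_on {A..A + \<tau>} r"
    "\<And>t. t \<in> {A..A + \<tau>} \<Longrightarrow> (v has_integral (r t - \<alpha>\<^sup>2)) {A..t}"
    "((\<lambda>t. 1 / r t) has_integral D) {A..A + \<tau>}"
    "((\<lambda>t. (v t)\<^sup>2) has_integral (4 * (\<beta> - \<alpha>)\<^sup>2 / D)) {A..A + \<tau>}"
proof
  \<comment> \<open>If \<rho> = sqrt r is linear in s with slope (\<beta> - \<alpha>) / D, then dt =
    \<rho>^2 ds makes \<rho>^3 linear in t with three times that slope; w is \<rho>^3.\<close>
  define w where "w = (\<lambda>t. \<alpha> ^ 3 + 3 * (\<beta> - \<alpha>) / D * (t - A))"
  define r where "r = (\<lambda>t. w t powr (2/3))"
  define v where "v = (\<lambda>t. 2 * (\<beta> - \<alpha>) / D * w t powr (-1/3))"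
  have [measurable]: "w \<in> borel_measurable borel" unfolding w_def by measurable
  show "r \<in> borel_measurable borel" "v \<in> borel_measurable borel"
    unfolding r_def v_def by measurable
  have sq: "(x ^ 3) powr (2/3) = x\<^sup>2" and id: "(x ^ 3) powr (1/3) = x" if "x \<ge> 0" for x :: real
  proof -
    have *: "(x ^ 3) powr p = x powr (3 * p)" if "x > 0" for p
      using powr_powr[of x 3 p] that by (simp only: powr_numeral)
    show "(x ^ 3) powr (2/3) = x\<^sup>2" "(x ^ 3) powr (1/3) = x"
      using that *[of "2/3"] *[of "1/3"] by (cases "x = 0", simp_all)+
  qed
  have pos: "\<alpha>\<^sup>2 + \<alpha> * \<beta> + \<beta>\<^sup>2 > 0"
    using \<alpha> \<beta> by (intro add_nonneg_pos) auto
  show \<tau>: "\<tau> > 0" unfolding \<tau>_def using pos D by simp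
  have wA: "w A = \<alpha> ^ 3" by (simp add: w_def)
  have wB: "w (A + \<tau>) = \<beta> ^ 3"
  proof -
    have "3 * (\<beta> - \<alpha>) / D * \<tau> = (\<beta> - \<alpha>) * (\<alpha>\<^sup>2 + \<alpha> * \<beta> + \<beta>\<^sup>2)"
      using D by (simp add: \<tau>_def)
    also have "\<dots> = \<beta> ^ 3 - \<alpha> ^ 3"
      by (simp add: algebra_simps power2_eq_square power3_eq_cube)
    finally show ?thesis by (simp add: w_def)
  qed
  have w_conv: "w t = (1 - (t - A) / \<tau>) * \<alpha> ^ 3 + (t - A) / \<tau> * \<beta> ^ 3" for t
  proof -
    have "3 * (\<beta> - \<alpha>) / D * \<tau> = \<beta> ^ 3 - \<alpha> ^ 3" using wB by (simp add: w_def)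
    then have "3 * (\<beta> - \<alpha>) / D = (\<beta> ^ 3 - \<alpha> ^ 3) / \<tau>" using \<tau> by (simp add: field_simps)
    then have "w t = \<alpha> ^ 3 + (\<beta> ^ 3 - \<alpha> ^ 3) / \<tau> * (t - A)" unfolding w_def by (simp only:)
    then show ?thesis by (simp add: algebra_simps diff_divide_distrib)
  qed
  have w_pos: "w t > 0" if "t \<in> {A<..A + \<tau>}" for t
  proof -
    have "(1 - (t - A) / \<tau>) * \<alpha> ^ 3 \<ge> 0" using that \<tau> \<alpha> by (intro mult_nonneg_nonneg) (auto simp: field_simps)
    moreover have "(t - A) / \<tau> * \<beta> ^ 3 > 0" using that \<tau> \<beta> by simp
    ultimately show ?thesis unfolding w_conv by simp
  qed
  have w_min: "w t \<ge> min \<alpha> \<beta> ^ 3" if "t \<in> {A..A + \<tau>}" for t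
  proof -
    define s where "s = (t - A) / \<tau>"
    have s: "0 \<le> s" "s \<le> 1" using that \<tau> by (auto simp: s_def)
    have "min \<alpha> \<beta> ^ 3 \<le> \<alpha> ^ 3" "min \<alpha> \<beta> ^ 3 \<le> \<beta> ^ 3"
      using \<alpha> \<beta> by (auto intro!: power_mono)
    then have "(1 - s) * min \<alpha> \<beta> ^ 3 \<le> (1 - s) * \<alpha> ^ 3" "s * min \<alpha> \<beta> ^ 3 \<le> s * \<beta> ^ 3"
      using s by (auto intro!: mult_left_mono)
    then show ?thesis unfolding w_conv s_def[symmetric] by (simp add: algebra_simps)
  qed
  show "r A = \<alpha>\<^sup>2" "r (A + \<tau>) = \<beta>\<^sup>2" using \<alpha> \<beta> by (simp_all add: r_def wA wB sq)
  show r_pos: "r t > 0" if "t \<in> {A<..A + \<tau>}" for t using w_pos[OF that] by (simp add: r_def)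
  show r_min: "r t \<ge> (min \<alpha> \<beta>)\<^sup>2" if "t \<in> {A..A + \<tau>}" for t
  proof -
    have "(min \<alpha> \<beta>)\<^sup>2 = (min \<alpha> \<beta> ^ 3) powr (2/3)" using \<alpha> \<beta> by (subst sq) auto
    also have "\<dots> \<le> r t" unfolding r_def using w_min[OF that] \<alpha> \<beta> by (intro powr_mono2) auto
    finally show ?thesis .
  qed
  have w_nonneg: "w t \<ge> 0" if "t \<in> {A..A + \<tau>}" for t
    using w_pos[of t] wA \<alpha> that by (cases "t = A") auto
  have cw: "continuous_on S w" for S unfolding w_def by (intro continuous_intros)
  have cpow: "continuous_on {A..A + \<tau>} (\<lambda>t. w t powr p)" if "p > 0" for p
    using that w_nonneg by (intro continuous_on_powr' cw continuous_intros) auto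
  show cr: "continuous_on {A..A + \<tau>} r" unfolding r_def by (intro cpow) simp
  have dw: "(w has_real_derivative 3 * (\<beta> - \<alpha>) / D) (at t)" for t
    unfolding w_def using D by (auto intro!: derivative_eq_intros)
  have dpow: "((\<lambda>t. w t powr p) has_real_derivative p * w t powr (p - 1) * (3 * (\<beta> - \<alpha>) / D)) (at t)"
    if "t \<in> {A<..A + \<tau>}" for t p
    using DERIV_chain2[OF has_real_derivative_powr[OF w_pos[OF that]] dw] .
  have dr: "(r has_real_derivative v t) (at t)" if "t \<in> {A<..A + \<tau>}" for t
    unfolding r_def
  proof (rule DERIV_cong[OF dpow[OF that]])
    show "2 / 3 * w t powr (2 / 3 - 1) * (3 * (\<beta> - \<alpha>) / D) = v t"
      using D by (simp add: v_def field_simps)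
  qed
  show "(v has_integral (r t - \<alpha>\<^sup>2)) {A..t}" if "t \<in> {A..A + \<tau>}" for t
  proof -
    have "(v has_integral (r t - r A)) {A..t}"
      using that dr by (intro fundamental_theorem_of_calculus_interior continuous_on_subset[OF cr])
        (auto simp: has_real_derivative_iff_has_vector_derivative[symmetric])
    then show ?thesis using \<open>r A = \<alpha>\<^sup>2\<close> by simp
  qed
  have inv: "1 / r t = w t powr (-2/3)" for t by (simp add: r_def powr_minus_divide)
  show pot: "((\<lambda>t. 1 / r t) has_integral D) {A..A + \<tau>}"
  proof (cases "\<alpha> = \<beta>")
    case True
    then have "r t = \<alpha>\<^sup>2" for t using \<alpha> by (simp add: r_def w_def sq)
    moreover have "\<tau> = D * \<alpha>\<^sup>2" by (simp add: \<tau>_def True power2_eq_square)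
    ultimately show ?thesis
      using has_integral_const_real[of "1 / \<alpha>\<^sup>2" A "A + \<tau>"] True \<beta> \<tau> by (simp add: less_imp_le)
  next
    case False
    \<comment> \<open>Since ds = dt / r, a primitive of 1 / r is s itself, here recovered from
      \<rho> = w powr (1/3). Dividing by the slope is why \<alpha> = \<beta> is separate.\<close>
    define g where "g = (\<lambda>t. D / (\<beta> - \<alpha>) * w t powr (1/3))"
    have "((\<lambda>t. 1 / r t) has_integral (g (A + \<tau>) - g A)) {A..A + \<tau>}"
    proof (intro fundamental_theorem_of_calculus_interior)
      show "continuous_on {A..A + \<tau>} g" unfolding g_def by (intro continuous_intros cpow) simp
      fix t assume "t \<in> {A<..<A + \<tau>}"
      then have "(g has_real_derivative D / (\<beta> - \<alpha>) * ((1/3) * w t powr (1/3 - 1) * (3 * (\<beta> - \<alpha>) / D))) (at t)"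
        unfolding g_def by (intro DERIV_cmult dpow) auto
      moreover have "D / (\<beta> - \<alpha>) * ((1/3) * w t powr (1/3 - 1) * (3 * (\<beta> - \<alpha>) / D)) = 1 / r t"
      proof -
        have "D / (\<beta> - \<alpha>) * ((1/3) * x * (3 * (\<beta> - \<alpha>) / D)) = x" for x
          using False D by (simp add: divide_simps)
        then show ?thesis by (simp only: inv) simp
      qed
      ultimately show "(g has_vector_derivative 1 / r t) (at t)"
        by (simp add: has_real_derivative_iff_has_vector_derivative[symmetric])
    qed (use \<tau> in auto)
    moreover have "g (A + \<tau>) - g A = D"
      using False \<alpha> \<beta> by (simp add: g_def wA wB id divide_simps) (simp add: algebra_simps)
    ultimately show ?thesis by simp
  qed
  \<comment> \<open>For constant d\<rho>/ds the squared speed is 4 (d\<rho>/ds)^2 / r, so the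
    kinetic integral is a multiple of the potential one.\<close>
  have "(v t)\<^sup>2 = (4 * (\<beta> - \<alpha>)\<^sup>2 / D\<^sup>2) * (1 / r t)" for t
  proof -
    have "(w t powr (-1/3))\<^sup>2 = w t powr (-2/3)"
      by (simp add: power2_eq_square powr_add[symmetric])
    moreover have "(2 * (\<beta> - \<alpha>) / D * x)\<^sup>2 = 4 * (\<beta> - \<alpha>)\<^sup>2 / D\<^sup>2 * x\<^sup>2" for x
      by (simp add: power2_eq_square algebra_simps)
    ultimately show ?thesis unfolding inv v_def by (simp only:)
  qed
  then show "((\<lambda>t. (v t)\<^sup>2) has_integral (4 * (\<beta> - \<alpha>)\<^sup>2 / D)) {A..A + \<tau>}"
    using has_integral_mult_right[OF pot, of "4 * (\<beta> - \<alpha>)\<^sup>2 / D\<^sup>2"] D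
    by (simp add: power2_eq_square)
qed

text \<open>Arcs of equal Levi-Civita duration D are joined end to end. The integral of r is only
  bounded below: with m the smaller end value of sqrt r, an arc lasts at least D m^2 and has r at
  least m^2.\<close>

lemma polygonal_path_exists:
  fixes h :: "nat \<Rightarrow> real" and D :: real
  assumes D: "D > 0" and h0: "h 0 = 0" and h: "\<And>i. i > 0 \<Longrightarrow> h i > 0"
  defines "\<tau> \<equiv> \<lambda>i. D * ((h i)\<^sup>2 + h i * h (Suc i) + (h (Suc i))\<^sup>2) / 3"
  shows "\<exists>r v. r \<in> borel_measurable borel \<and> v \<in> borel_measurable borel \<and>
      r (\<Sum>i<n. \<tau> i) = (h n)\<^sup>2 \<and>
      (\<forall>t\<in>{0<..(\<Sum>i<n. \<tau> i)}. r t > 0) \<and>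
      (\<forall>t\<in>{0..(\<Sum>i<n. \<tau> i)}. (v has_integral r t) {0..t}) \<and>
      ((\<lambda>t. 1 / r t) has_integral n * D) {0..(\<Sum>i<n. \<tau> i)} \<and>
      ((\<lambda>t. (v t)\<^sup>2) has_integral (\<Sum>i<n. 4 * (h (Suc i) - h i)\<^sup>2 / D)) {0..(\<Sum>i<n. \<tau> i)} \<and>
      r integrable_on {0..(\<Sum>i<n. \<tau> i)} \<and>
      (\<Sum>i<n. D * (min (h i) (h (Suc i))) ^ 4) \<le> integral {0..(\<Sum>i<n. \<tau> i)} r"
proof (induction n)
  case 0
  show ?case by (rule exI[of _ "\<lambda>t. 0"], rule exI[of _ "\<lambda>t. 0"]) (auto simp: h0 integrable_0)
next
  case (Suc n)
  define A where "A = (\<Sum>i<n. \<tau> i)"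
  define B where "B = A + \<tau> n"
  have h_nonneg: "h i \<ge> 0" for i
    using h[of i] h0 by (cases "i = 0") auto
  have hn: "h n \<ge> 0" "h (Suc n) > 0"
    using h h_nonneg by auto
  have \<tau>_nonneg: "\<tau> i \<ge> 0" for i
    unfolding \<tau>_def using D h_nonneg by simp
  have A: "A \<ge> 0" unfolding A_def using \<tau>_nonneg by (simp add: sum_nonneg)
  from Suc.IH obtain r v where [measurable]: "r \<in> borel_measurable borel" "v \<in> borel_measurable borel"
    and rA: "r A = (h n)\<^sup>2" and r_pos: "\<And>t. t \<in> {0<..A} \<Longrightarrow> r t > 0"
    and rv: "\<And>t. t \<in> {0..A} \<Longrightarrow> (v has_integral r t) {0..t}"
    and pot: "((\<lambda>t. 1 / r t) has_integral n * D) {0..A}"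
    and kin: "((\<lambda>t. (v t)\<^sup>2) has_integral (\<Sum>i<n. 4 * (h (Suc i) - h i)\<^sup>2 / D)) {0..A}"
    and r_int: "r integrable_on {0..A}"
    and lower: "(\<Sum>i<n. D * (min (h i) (h (Suc i))) ^ 4) \<le> integral {0..A} r"
    unfolding A_def[symmetric] by blast
  have \<tau>n: "D * ((h n)\<^sup>2 + h n * h (Suc n) + (h (Suc n))\<^sup>2) / 3 = \<tau> n" by (simp add: \<tau>_def)
  obtain s u where
    [measurable]: "s \<in> borel_measurable borel" "u \<in> borel_measurable borel"
    and arc: "\<tau> n > 0" "s A = (h n)\<^sup>2" "s B = (h (Suc n))\<^sup>2"
      "\<And>t. t \<in> {A<..B} \<Longrightarrow> s t > 0"
      "\<And>t. t \<in> {A..B} \<Longrightarrow> s t \<ge> (min (h n) (h (Suc n)))\<^sup>2"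
      "continuous_on {A..B} s"
      "\<And>t. t \<in> {A..B} \<Longrightarrow> (u has_integral (s t - (h n)\<^sup>2)) {A..t}"
      "((\<lambda>t. 1 / s t) has_integral D) {A..B}"
      "((\<lambda>t. (u t)\<^sup>2) has_integral (4 * (h (Suc n) - h n)\<^sup>2 / D)) {A..B}"
    by (rule kepler_arc[OF hn D, where A=A, unfolded \<tau>n, folded B_def]) (rule that; assumption)
  define r' where "r' = (\<lambda>t. if t \<le> A then r t else s t)"
  define v' where "v' = (\<lambda>t. if t \<le> A then v t else u t)"
  have AB: "A < B" using arc(1) by (simp add: B_def)
  have r'_s: "r' t = s t" if "t \<in> {A..B}" for t
    using that arc(2) rA by (cases "t = A") (auto simp: r'_def)
  have comb: "(f has_integral (x + y)) {0..t}"
    if f1: "(f1 has_integral x) {0..A}" and f2: "(f2 has_integral y) {A..t}" and t: "A \<le> t"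
      and e1: "\<And>t. t \<le> A \<Longrightarrow> f t = f1 t" and e2: "\<And>t. t > A \<Longrightarrow> f t = f2 t"
    for f f1 f2 :: "real \<Rightarrow> real" and x y t
  proof (rule has_integral_combine[OF A t])
    show "(f has_integral x) {0..A}" using has_integral_eq[OF _ f1, of f] e1 by simp
    show "(f has_integral y) {A..t}"
      by (rule has_integral_spike_finite[OF _ _ f2, of "{A}"]) (auto simp: e2)
  qed
  have "(\<Sum>i<Suc n. \<tau> i) = B" by (simp add: A_def B_def)
  moreover have "r' \<in> borel_measurable borel" "v' \<in> borel_measurable borel"
    unfolding r'_def v'_def by measurable
  moreover have "r' B = (h (Suc n))\<^sup>2" using r'_s[of B] AB arc(3) by simp
  moreover have "r' t > 0" if "t \<in> {0<..B}" for t
    using that r_pos[of t] arc(4)[of t] by (auto simp: r'_def)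
  moreover have "(v' has_integral r' t) {0..t}" if "t \<in> {0..B}" for t
  proof (cases "t \<le> A")
    case True
    then have "(v' has_integral r t) {0..t}"
      using has_integral_eq[OF _ rv[of t], of v'] that by (simp add: v'_def)
    then show ?thesis using True by (simp add: r'_def)
  next
    case False
    then have "(v' has_integral (h n)\<^sup>2 + (s t - (h n)\<^sup>2)) {0..t}"
      using that rv[of A] A rA by (intro comb[OF rv[of A, unfolded rA] arc(7)]) (auto simp: v'_def)
    then show ?thesis using False by (simp add: r'_def)
  qed
  moreover have "((\<lambda>t. 1 / r' t) has_integral real n * D + D) {0..B}"
    using AB by (intro comb[OF pot arc(8)]) (auto simp: r'_def)
  moreover have "((\<lambda>t. (v' t)\<^sup>2) has_integral (\<Sum>i<n. 4 * (h (Suc i) - h i)\<^sup>2 / D) + 4 * (h (Suc n) - h n)\<^sup>2 / D) {0..B}"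
    using AB by (intro comb[OF kin arc(9)]) (auto simp: v'_def)
  moreover have r'_int: "(r' has_integral integral {0..A} r + integral {A..B} s) {0..B}"
    using AB r_int integrable_continuous_real[OF arc(6)]
    by (intro comb[of r _ s]) (auto simp: r'_def)
  moreover have "D * (min (h n) (h (Suc n))) ^ 4 \<le> integral {A..B} s"
  proof -
    let ?m = "min (h n) (h (Suc n))"
    have m: "?m \<ge> 0" using hn by auto
    have "?m\<^sup>2 \<le> (h n)\<^sup>2" "?m * ?m \<le> h n * h (Suc n)" "?m\<^sup>2 \<le> (h (Suc n))\<^sup>2"
      using hn by (auto intro!: power_mono mult_mono)
    then have "D * (3 * ?m\<^sup>2) \<le> D * ((h n)\<^sup>2 + h n * h (Suc n) + (h (Suc n))\<^sup>2)"
      using D by (intro mult_left_mono) (auto simp: power2_eq_square)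
    then have "D * ?m\<^sup>2 \<le> \<tau> n" by (simp add: \<tau>_def)
    then have "D * ?m\<^sup>2 * ?m\<^sup>2 \<le> \<tau> n * ?m\<^sup>2" by (intro mult_right_mono) auto
    also have "\<dots> = integral {A..B} (\<lambda>t. ?m\<^sup>2)" using AB by (simp add: B_def)
    also have "\<dots> \<le> integral {A..B} s"
      using arc(5) by (intro integral_le integrable_continuous_real arc(6) continuous_intros) auto
    finally show ?thesis by (simp add: power4_eq_xxxx power2_eq_square mult.assoc)
  qed
  ultimately show ?case
    using lower by (intro exI[of _ r'] exI[of _ v']) (auto simp: algebra_simps integral_unique)
qed

text \<open>The bound is the action of the overview for a polygon in s: N * D is the total
  Levi-Civita time, hence the integral of 1 / r.\<close>

lemma radial_polygon:
  fixes h :: "nat \<Rightarrow> real" and D :: real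
  assumes D: "D > 0" and N: "N > 0" and h0: "h 0 = 0" and h: "\<And>i. i > 0 \<Longrightarrow> h i > 0"
    and T: "T = (\<Sum>i<N. D * ((h i)\<^sup>2 + h i * h (Suc i) + (h (Suc i))\<^sup>2) / 3)"
  shows "\<exists>r v. radial T r v \<and> radial_action T r v \<le>
    2 * (\<Sum>i<N. (h (Suc i) - h i)\<^sup>2) / D + N * D - D * (\<Sum>i<N. (min (h i) (h (Suc i))) ^ 4)"
proof -
  from polygonal_path_exists[where n=N and h=h, OF D h0 h, folded T] obtain r v where
    rm[measurable]: "r \<in> borel_measurable borel" and vm[measurable]: "v \<in> borel_measurable borel"
    and r_pos: "\<And>t. t \<in> {0<..T} \<Longrightarrow> r t > 0"
    and rv: "\<And>t. t \<in> {0..T} \<Longrightarrow> (v has_integral r t) {0..t}"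
    and pot: "((\<lambda>t. 1 / r t) has_integral N * D) {0..T}"
    and kin: "((\<lambda>t. (v t)\<^sup>2) has_integral (\<Sum>i<N. 4 * (h (Suc i) - h i)\<^sup>2 / D)) {0..T}"
    and r_int: "r integrable_on {0..T}"
    and lower: "(\<Sum>i<N. D * (min (h i) (h (Suc i))) ^ 4) \<le> integral {0..T} r"
    by blast
  have r_nonneg: "0 \<le> r t" if "t \<in> {0..T}" for t
    using integral_unique[OF rv, of 0] r_pos[of t] that by (cases "t = 0") auto
  have i1: "set_integrable lborel {0..T} (\<lambda>t. 1 / r t)"
    using pot r_nonneg by (intro set_integrable_lborel_nonneg) auto
  have i2: "set_integrable lborel {0..T} (\<lambda>t. (v t)\<^sup>2)"
    using kin by (intro set_integrable_lborel_nonneg) auto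
  have i3: "set_integrable lborel {0..T} v"
  proof (rule set_integrable_bound)
    show "set_integrable lborel {0..T} (\<lambda>t. 1 + (v t)\<^sup>2)"
      by (intro set_integral_add i2 borel_integrable_atLeastAtMost' continuous_intros)
    show "set_borel_measurable lborel {0..T} v" by (simp add: set_borel_measurable_def)
    \<comment> \<open>On a bounded interval square integrability implies integrability, through this
      bound.\<close>
    have "\<bar>x\<bar> \<le> 1 + x\<^sup>2" for x :: real
      using zero_le_power2[of "\<bar>x\<bar> - 1"] by (simp add: power2_eq_square algebra_simps)
    then show "AE t in lborel. t \<in> {0..T} \<longrightarrow> norm (v t) \<le> norm (1 + (v t)\<^sup>2)"
      by (auto intro!: AE_I2)
  qed
  have "AE t in lborel. t \<noteq> (0::real)" by (rule AE_lborel_singleton)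
  then have ae: "AE t in lborel. t \<in> {0..T} \<longrightarrow> r t \<noteq> 0"
  proof eventually_elim
    case (elim t)
    then show ?case using r_pos[of t] by auto
  qed
  have "radial T r v"
    unfolding radial_def by (intro conjI ballI i1 i2 i3 r_nonneg ae integral_unique[OF rv, symmetric])
  moreover have "radial_action T r v \<le>
    2 * (\<Sum>i<N. (h (Suc i) - h i)\<^sup>2) / D + N * D - D * (\<Sum>i<N. (min (h i) (h (Suc i))) ^ 4)"
  proof -
    have "integral {0..T} (\<lambda>t. (v t)\<^sup>2 / 2) = (\<Sum>i<N. 4 * (h (Suc i) - h i)\<^sup>2 / D) / 2"
      using kin by (simp add: integral_unique)
    also have "\<dots> = 2 * (\<Sum>i<N. (h (Suc i) - h i)\<^sup>2) / D"
      by (simp add: sum_distrib_left sum_divide_distrib field_simps)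
    finally show ?thesis
      unfolding radial_action_def using pot lower by (simp add: integral_unique sum_distrib_left)
  qed
  ultimately show ?thesis by blast
qed

section \<open>Parabolic coordinates\<close>

text \<open>The point (\<xi>, \<eta>) with both coordinates nonnegative: the complex square root of
  x + i|y|. Folding the sign of y removes the choice of a branch, so the map is continuous through
  collisions.\<close>

definition parabolic :: "real \<times> real \<Rightarrow> real \<times> real" where
  "parabolic p = (sqrt ((norm p + fst p) / 2), sqrt ((norm p - fst p) / 2))"

lemma abs_fst_le_norm: "\<bar>fst p\<bar> \<le> norm (p :: real \<times> real)"
  using norm_fst_le[of "fst p" "snd p"] by simp

lemma parabolic_nonneg: "fst (parabolic p) \<ge> 0" "snd (parabolic p) \<ge> 0"
  using abs_fst_le_norm[of p] by (auto simp: parabolic_def)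

lemma parabolic_squares:
  "(fst (parabolic p))\<^sup>2 = (norm p + fst p) / 2" "(snd (parabolic p))\<^sup>2 = (norm p - fst p) / 2"
  using abs_fst_le_norm[of p] by (auto simp: parabolic_def)

lemma norm_parabolic: "norm (parabolic p) = sqrt (norm p)"
proof -
  have "norm (parabolic p) = sqrt ((fst (parabolic p))\<^sup>2 + (snd (parabolic p))\<^sup>2)"
    by (simp add: norm_prod_def)
  then show ?thesis by (simp add: parabolic_squares field_simps)
qed

lemma continuous_on_parabolic: "continuous_on S q \<Longrightarrow> continuous_on S (\<lambda>t. parabolic (q t))"
  unfolding parabolic_def by (intro continuous_intros) auto

text \<open>For z^2 = x + i|y| this is |z - z'| |z + z'| = |z^2 - z'^2|, and folding the plane along
  the x-axis does not increase distances. It replaces the derivative of the square root.\<close>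

lemma norm_parabolic_diff_sum_le:
  "norm (parabolic p - parabolic p') * norm (parabolic p + parabolic p') \<le> norm (p - p')"
proof -
  obtain a b where z: "parabolic p = (a, b)" by (cases "parabolic p")
  obtain a' b' where z': "parabolic p' = (a', b')" by (cases "parabolic p'")
  have prod: "2 * fst (parabolic p) * snd (parabolic p) = \<bar>snd p\<bar>" for p
  proof (rule power2_eq_imp_eq)
    have "(2 * fst (parabolic p) * snd (parabolic p))\<^sup>2 = 4 * (fst (parabolic p))\<^sup>2 * (snd (parabolic p))\<^sup>2"
      by (simp add: power_mult_distrib)
    also have "\<dots> = (norm p)\<^sup>2 - (fst p)\<^sup>2"
      unfolding parabolic_squares by (simp add: power2_eq_square field_simps)
    also have "\<dots> = \<bar>snd p\<bar>\<^sup>2" by (simp add: norm_prod_def)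
    finally show "(2 * fst (parabolic p) * snd (parabolic p))\<^sup>2 = \<bar>snd p\<bar>\<^sup>2" .
  qed (simp_all add: parabolic_nonneg)
  have diff: "(fst (parabolic p))\<^sup>2 - (snd (parabolic p))\<^sup>2 = fst p" for p
    unfolding parabolic_squares by (simp add: field_simps)
  have x: "a\<^sup>2 - b\<^sup>2 = fst p" "a'\<^sup>2 - b'\<^sup>2 = fst p'" and y: "2 * a * b = \<bar>snd p\<bar>" "2 * a' * b' = \<bar>snd p'\<bar>"
    using diff[of p] diff[of p'] prod[of p] prod[of p'] by (simp_all add: z z')
  have "(norm (parabolic p - parabolic p') * norm (parabolic p + parabolic p'))\<^sup>2
      = ((a - a')\<^sup>2 + (b - b')\<^sup>2) * ((a + a')\<^sup>2 + (b + b')\<^sup>2)"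
    by (simp add: z z' norm_prod_def power_mult_distrib)
  \<comment> \<open>Multiplicativity of the complex modulus, written out in real
    coordinates.\<close>
  also have "\<dots> = ((a\<^sup>2 - b\<^sup>2) - (a'\<^sup>2 - b'\<^sup>2))\<^sup>2 + (2 * a * b - 2 * a' * b')\<^sup>2"
    by algebra
  also have "\<dots> = (fst p - fst p')\<^sup>2 + (\<bar>snd p\<bar> - \<bar>snd p'\<bar>)\<^sup>2"
    unfolding x y ..
  also have "\<dots> \<le> (fst p - fst p')\<^sup>2 + (snd p - snd p')\<^sup>2"
    by (simp flip: abs_le_square_iff)
  also have "\<dots> = (norm (p - p'))\<^sup>2" by (simp add: norm_prod_def)
  finally show ?thesis by (rule power2_le_imp_le) simp
qed

lemma norm_pair_mono:
  fixes a b c d :: real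
  assumes "\<bar>a\<bar> \<le> \<bar>c\<bar>" "\<bar>b\<bar> \<le> \<bar>d\<bar>"
  shows "norm (a, b) \<le> norm (c, d)"
  using assms by (simp add: norm_prod_def abs_le_square_iff add_mono)

text \<open>Truncating both coordinates at a small height makes the coordinates locally constant near
  collisions, where the hypothesis on the speed gives no information.\<close>

lemma norm_parabolic_diff_le_integral:
  fixes q v :: "real \<Rightarrow> real \<times> real" and G :: "real \<Rightarrow> real"
  assumes ab: "a \<le> b" and q: "continuous_on {a..b} q"
    and qv: "\<And>s t. \<lbrakk>a \<le> s; s \<le> t; t \<le> b\<rbrakk> \<Longrightarrow> q t - q s = integral {s..t} v"
    and v: "v integrable_on {a..b}" and nv: "(\<lambda>t. norm (v t)) integrable_on {a..b}"
    and G: "G integrable_on {a..b}" and G_nonneg: "\<And>t. t \<in> {a..b} \<Longrightarrow> 0 \<le> G t"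
    and vG: "\<And>t. \<lbrakk>t \<in> {a..b}; q t \<noteq> 0\<rbrakk> \<Longrightarrow> norm (v t) \<le> 2 * norm (parabolic (q t)) * G t"
  shows "norm (parabolic (q b) - parabolic (q a)) \<le> integral {a..b} G"
proof -
  define z where "z = (\<lambda>t. parabolic (q t))"
  have z: "continuous_on {a..b} z" unfolding z_def by (rule continuous_on_parabolic[OF q])
  have near: "\<exists>d>0. \<forall>u\<in>{a..b}. \<bar>u - x\<bar> < d \<longrightarrow> norm (z u - z x) < e" if "x \<in> {a..b}" "e > 0" for x e
    using z[unfolded continuous_on_iff] that by (force simp: dist_norm)
  have G_sub: "G integrable_on {s..t}" if "a \<le> s" "t \<le> b" for s t
    using G by (rule integrable_on_subinterval) (use that in auto)
  have G_int: "0 \<le> integral {s..t} G" if "a \<le> s" "t \<le> b" for s t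
    using that by (intro integral_nonneg G_sub G_nonneg) auto
  \<comment> \<open>The factor 1 - e pays for freezing \<open>norm (z t + z s)\<close> on short
    intervals; 4 * e is the truncation error, 2 * e at each end.\<close>
  have main: "(1 - e) * (norm (z b - z a) - 4 * e) \<le> integral {a..b} G" if e: "0 < e" "e < 1" for e
  proof -
    define sh where "sh = (\<lambda>x::real. max (x - e) 0)"
    define Z where "Z = (\<lambda>t. (sh (fst (z t)), sh (snd (z t))))"
    have Z_le: "norm (Z t - Z s) \<le> norm (z t - z s)" for s t
    proof -
      have "norm (Z t - Z s) \<le> norm (fst (z t) - fst (z s), snd (z t) - snd (z s))"
        unfolding Z_def diff_Pair by (rule norm_pair_mono) (auto simp: sh_def)
      also have "\<dots> = norm (z t - z s)" by (simp add: minus_prod_def)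
      finally show ?thesis .
    qed
    have Z_z: "norm (z t - Z t) \<le> 2 * e" for t
    proof -
      have "norm (z t - Z t) \<le> \<bar>fst (z t - Z t)\<bar> + \<bar>snd (z t - Z t)\<bar>"
        using norm_Pair_le[of "fst (z t - Z t)" "snd (z t - Z t)"] unfolding prod.collapse by simp
      also have "\<dots> \<le> e + e"
        using parabolic_nonneg[of "q t"] e by (intro add_mono) (auto simp: Z_def sh_def z_def)
      finally show ?thesis by simp
    qed
    \<comment> \<open>The estimate adds up over adjacent intervals, so by \<open>Bolzano\<close> it
      suffices on all short intervals around each point. The trivial premises give the claim the
      shape of that rule.\<close>
    have "a \<le> a \<and> a \<le> b \<and> b \<le> b \<longrightarrow> (1 - e) * norm (Z b - Z a) \<le> integral {a..b} G"
    proof (rule Bolzano[OF ab, of "\<lambda>s t. a \<le> s \<and> s \<le> t \<and> t \<le> b \<longrightarrow> (1 - e) * norm (Z t - Z s) \<le> integral {s..t} G"])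
      fix s t u
      assume 1: "a \<le> s \<and> s \<le> t \<and> t \<le> b \<longrightarrow> (1 - e) * norm (Z t - Z s) \<le> integral {s..t} G"
        and 2: "a \<le> t \<and> t \<le> u \<and> u \<le> b \<longrightarrow> (1 - e) * norm (Z u - Z t) \<le> integral {t..u} G"
        and st: "s \<le> t" "t \<le> u"
      show "a \<le> s \<and> s \<le> u \<and> u \<le> b \<longrightarrow> (1 - e) * norm (Z u - Z s) \<le> integral {s..u} G"
      proof
        assume *: "a \<le> s \<and> s \<le> u \<and> u \<le> b"
        have "norm (Z u - Z s) \<le> norm (Z u - Z t) + norm (Z t - Z s)"
          using norm_triangle_ineq[of "Z u - Z t" "Z t - Z s"] by simp
        then have "(1 - e) * norm (Z u - Z s) \<le> (1 - e) * norm (Z t - Z s) + (1 - e) * norm (Z u - Z t)"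
          using e mult_left_mono[of "norm (Z u - Z s)" "norm (Z u - Z t) + norm (Z t - Z s)" "1 - e"]
          by (simp add: algebra_simps)
        also have "\<dots> \<le> integral {s..t} G + integral {t..u} G"
          using 1 2 * st by (intro add_mono) auto
        also have "\<dots> = integral {s..u} G"
          using * st by (intro Henstock_Kurzweil_Integration.integral_combine G_sub) auto
        finally show "(1 - e) * norm (Z u - Z s) \<le> integral {s..u} G" .
      qed
    next
      fix x assume "a \<le> x" "x \<le> b"
      then have x: "x \<in> {a..b}" by simp
      show "\<exists>d>0. \<forall>s t. s \<le> x \<and> x \<le> t \<and> t - s < d \<longrightarrow>
          (a \<le> s \<and> s \<le> t \<and> t \<le> b \<longrightarrow> (1 - e) * norm (Z t - Z s) \<le> integral {s..t} G)"
      proof (cases "q x = 0")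
        case True
        \<comment> \<open>Near a collision both coordinates stay below e, so the truncated path Z is
          locally 0 and the estimate is trivial.\<close>
        then have "z x = 0" using norm_parabolic[of "q x"] by (simp add: z_def)
        with near[OF x e(1)] obtain d where d: "d > 0" "\<And>u. u \<in> {a..b} \<Longrightarrow> \<bar>u - x\<bar> < d \<Longrightarrow> norm (z u) < e"
          by auto
        have "Z u = 0" if "u \<in> {a..b}" "\<bar>u - x\<bar> < d" for u
        proof -
          have "fst (z u) < e" "snd (z u) < e"
            using d(2)[OF that] norm_fst_le[of "fst (z u)" "snd (z u)"] norm_snd_le[of "snd (z u)" "fst (z u)"]
            by auto
          then show ?thesis by (simp add: Z_def sh_def zero_prod_def)
        qed
        then have "Z s = 0 \<and> Z t = 0" if "s \<le> x \<and> x \<le> t \<and> t - s < d" "a \<le> s \<and> s \<le> t \<and> t \<le> b" for s t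
          using that by auto
        then show ?thesis using d(1) G_int by (intro exI[of _ d]) auto
      next
        case False
        then have zx: "norm (z x) > 0" using norm_parabolic[of "q x"] by (simp add: z_def)
        with near[OF x, of "e / 2 * norm (z x)"] e obtain d
          where d: "d > 0" "\<And>u. u \<in> {a..b} \<Longrightarrow> \<bar>u - x\<bar> < d \<Longrightarrow> norm (z u - z x) < e / 2 * norm (z x)"
          by auto
        have "(1 - e) * norm (Z t - Z s) \<le> integral {s..t} G"
          if st: "s \<le> x" "x \<le> t" "t - s < d" "a \<le> s" "t \<le> b" for s t
        proof -
          define m where "m = norm (z t + z s)"
          have close: "norm (z u - z x) < e / 2 * norm (z x)" if "u \<in> {s..t}" for u
            using that st by (intro d(2)) auto
          have "norm (2 *\<^sub>R z x) \<le> norm (z t + z s) + norm (z t - z x) + norm (z s - z x)"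
          proof -
            have eq: "2 *\<^sub>R z x = (z t + z s) - (z t - z x) - (z s - z x)" by (simp add: scaleR_2)
            show ?thesis unfolding eq
              using norm_triangle_ineq4[of "z t + z s - (z t - z x)" "z s - z x"]
                norm_triangle_ineq4[of "z t + z s" "z t - z x"] by linarith
          qed
          then have m1: "m \<ge> (2 - e) * norm (z x)"
            using close[of t] close[of s] st by (simp add: m_def algebra_simps)
          have m: "m > 0" using m1 zx e by (smt (verit) mult_pos_pos)
          \<comment> \<open>Here the factor 1 - e is spent: (1 - e) (2 + e) is at most 2 -
            e.\<close>
          have m2: "(1 - e) * (2 * norm (z u)) \<le> m" if "u \<in> {s..t}" for u
          proof -
            have "norm (z u) \<le> (1 + e / 2) * norm (z x)"
              using close[OF that] norm_triangle_ineq2[of "z u" "z x"] by (simp add: algebra_simps)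
            then have "(1 - e) * (2 * norm (z u)) \<le> (1 - e) * (2 * ((1 + e / 2) * norm (z x)))"
              using e by (intro mult_left_mono) auto
            also have "\<dots> = (2 - e) * norm (z x) - e\<^sup>2 * norm (z x)"
              by (simp add: power2_eq_square algebra_simps)
            also have "\<dots> \<le> (2 - e) * norm (z x)" by simp
            finally show ?thesis using m1 by simp
          qed
          have nz: "q u \<noteq> 0" if "u \<in> {s..t}" for u
          proof
            assume "q u = 0"
            then have "z u = 0" using norm_parabolic[of "q u"] by (simp add: z_def)
            then have "norm (z x) < e / 2 * norm (z x)" using close[OF that] by simp
            then show False using zx e by (simp add: mult_less_cancel_right2 field_simps)
          qed
          have "(1 - e) * norm (z t - z s) * m \<le> (1 - e) * norm (q t - q s)"
            using norm_parabolic_diff_sum_le[of "q t" "q s"] e mult_left_mono[of _ _ "1 - e"]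
            by (simp add: z_def m_def mult.assoc)
          also have "\<dots> \<le> (1 - e) * integral {s..t} (\<lambda>u. norm (v u))"
          proof -
            have "norm (q t - q s) \<le> integral {s..t} (\<lambda>u. norm (v u))"
              unfolding qv[OF st(4) order_trans[OF st(1,2)] st(5)]
              by (rule integral_norm_bound_integral)
                 (use st in \<open>auto intro: integrable_on_subinterval[OF v] integrable_on_subinterval[OF nv]\<close>)
            then show ?thesis using e by (intro mult_left_mono) auto
          qed
          also have "\<dots> = integral {s..t} (\<lambda>u. (1 - e) * norm (v u))" by simp
          also have "\<dots> \<le> integral {s..t} (\<lambda>u. m * G u)"
          proof (rule integral_le)
            show "(\<lambda>u. (1 - e) * norm (v u)) integrable_on {s..t}"
              by (intro integrable_on_mult_right integrable_on_subinterval[OF nv]) (use st in auto)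
            show "(\<lambda>u. m * G u) integrable_on {s..t}"
              by (intro integrable_on_mult_right G_sub st)
            fix u assume u: "u \<in> {s..t}"
            then have ab: "u \<in> {a..b}" using st by auto
            have "(1 - e) * norm (v u) \<le> (1 - e) * (2 * norm (z u) * G u)"
              using e vG[OF ab nz[OF u]] by (intro mult_left_mono) (auto simp: z_def)
            also have "\<dots> = (1 - e) * (2 * norm (z u)) * G u" by simp
            also have "\<dots> \<le> m * G u" by (intro mult_right_mono m2 u G_nonneg ab)
            finally show "(1 - e) * norm (v u) \<le> m * G u" .
          qed
          also have "\<dots> = integral {s..t} G * m" by simp
          finally have "(1 - e) * norm (z t - z s) \<le> integral {s..t} G" using m by simp
          moreover have "(1 - e) * norm (Z t - Z s) \<le> (1 - e) * norm (z t - z s)"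
            using e by (intro mult_left_mono Z_le) auto
          ultimately show ?thesis by simp
        qed
        then show ?thesis using d(1) by (intro exI[of _ d]) auto
      qed
    qed
    then have "(1 - e) * norm (Z b - Z a) \<le> integral {a..b} G" using ab by simp
    moreover have "norm (z b - z a) - 4 * e \<le> norm (Z b - Z a)"
    proof -
      have eq: "z b - z a = (Z b - Z a) + (z b - Z b) - (z a - Z a)" by simp
      have "norm (z b - z a) \<le> norm (Z b - Z a) + norm (z b - Z b) + norm (z a - Z a)"
        unfolding eq
        using norm_triangle_ineq4[of "Z b - Z a + (z b - Z b)" "z a - Z a"]
          norm_triangle_ineq[of "Z b - Z a" "z b - Z b"] by linarith
      then show ?thesis using Z_z[of a] Z_z[of b] by simp
    qed
    then have "(1 - e) * (norm (z b - z a) - 4 * e) \<le> (1 - e) * norm (Z b - Z a)"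
      using e by (intro mult_left_mono) auto
    ultimately show ?thesis by simp
  qed
  have "((\<lambda>e. (1 - e) * (norm (z b - z a) - 4 * e)) \<longlongrightarrow> (1 - 0) * (norm (z b - z a) - 4 * 0)) (at_right 0)"
    by (intro tendsto_intros)
  moreover have "eventually (\<lambda>e. (1 - e) * (norm (z b - z a) - 4 * e) \<le> integral {a..b} G) (at_right 0)"
    using main by (subst eventually_at_right[of 0 1]) (auto intro!: exI[of _ 1])
  ultimately have "(1 - 0) * (norm (z b - z a) - 4 * 0) \<le> integral {a..b} G"
    by (rule tendsto_upperbound) simp
  then show ?thesis by (simp add: z_def)
qed

text \<open>The best parameter is l = sqrt (S / E). Adding e to both quantities keeps this quotient
  defined when one of them is 0; then e tends to 0.\<close>

lemma square_le_mult_if_AM_GM: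
  fixes X E S :: real
  assumes nonneg: "X \<ge> 0" "E \<ge> 0" "S \<ge> 0"
    and le: "\<And>l. l > 0 \<Longrightarrow> X \<le> l * E / 2 + S / (2 * l)"
  shows "X\<^sup>2 \<le> S * E"
proof -
  have "X\<^sup>2 \<le> (S + e) * (E + e)" if e: "e > 0" for e
  proof -
    define x y where "x = sqrt (S + e)" and "y = sqrt (E + e)"
    have pos: "x > 0" "y > 0" and sq: "S + e = x\<^sup>2" "E + e = y\<^sup>2" using nonneg e by (auto simp: x_def y_def)
    define l where "l = x / y"
    have l: "l > 0" using pos by (simp add: l_def)
    have "X \<le> l * E / 2 + S / (2 * l)" by (rule le[OF l])
    also have "\<dots> \<le> l * (E + e) / 2 + (S + e) / (2 * l)"
      using l e by (intro add_mono divide_right_mono mult_left_mono) auto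
    also have "\<dots> = x * y"
      unfolding sq using pos by (simp add: l_def field_simps power2_eq_square)
    finally have "X\<^sup>2 \<le> (x * y)\<^sup>2" using nonneg by (intro power_mono) auto
    then show ?thesis by (simp add: sq power_mult_distrib)
  qed
  moreover have "((\<lambda>e. (S + e) * (E + e)) \<longlongrightarrow> (S + 0) * (E + 0)) (at_right 0)"
    by (intro tendsto_intros)
  moreover have "eventually (\<lambda>e. X\<^sup>2 \<le> (S + e) * (E + e)) (at_right 0)"
    using calculation(1) by (subst eventually_at_right[of 0 1]) (auto intro!: exI[of _ 1])
  ultimately have "X\<^sup>2 \<le> (S + 0) * (E + 0)"
    by (intro tendsto_lowerbound[of "\<lambda>e. (S + e) * (E + e)"]) auto
  then show ?thesis by simp
qed

text \<open>Cauchy--Schwarz in Levi-Civita time for z = \<open>parabolic (q t)\<close>, whose speed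
  squared integrates to that of |v|^2 / 4. It is obtained from the additive bound G for every l,
  since sums of integrals can be compared locally.\<close>

lemma parabolic_energy_bound:
  assumes v: "H1_deriv T q v" and pot: "(\<lambda>t. 1 / norm (q t)) integrable_on {0..T}"
    and st: "0 \<le> s" "s \<le> t" "t \<le> T"
  shows "(norm (parabolic (q t) - parabolic (q s)))\<^sup>2
      \<le> integral {s..t} (\<lambda>u. 1 / norm (q u)) * integral {s..t} (\<lambda>u. (norm (v u))\<^sup>2 / 4)"
proof (rule square_le_mult_if_AM_GM)
  have sub: "{s..t} \<subseteq> {0..T}" using st by auto
  have i1: "(\<lambda>u. 1 / norm (q u)) integrable_on {s..t}"
    by (rule integrable_on_subinterval[OF pot sub])
  have i2: "(\<lambda>u. (norm (v u))\<^sup>2 / 4) integrable_on {s..t}"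
    by (intro integrable_on_divide integrable_on_subinterval[OF H1_deriv_integrable(2)[OF v] sub])
  have iv: "set_integrable lborel {0..T} v"
    using v unfolding H1_deriv_def by blast
  then have "set_integrable lborel {0..T} (\<lambda>u. norm (v u))"
    by (rule set_integrable_norm)
  then have i3: "(\<lambda>u. norm (v u)) integrable_on {s..t}"
    by (rule integrable_on_subinterval[OF set_borel_integral_eq_integral(1) sub])
  show "0 \<le> integral {s..t} (\<lambda>u. (norm (v u))\<^sup>2 / 4)" "0 \<le> integral {s..t} (\<lambda>u. 1 / norm (q u))"
    by (intro integral_nonneg i1 i2; simp)+
  fix l :: real assume l: "l > 0"
  define G where "G = (\<lambda>u. l / 2 * ((norm (v u))\<^sup>2 / 4) + 1 / (2 * l) * (1 / norm (q u)))"
  have "norm (parabolic (q t) - parabolic (q s)) \<le> integral {s..t} G"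
  proof (rule norm_parabolic_diff_le_integral)
    show "continuous_on {s..t} q" by (rule continuous_on_subset[OF H1_deriv_continuous[OF v] sub])
    show "v integrable_on {s..t}" by (rule integrable_on_subinterval[OF H1_deriv_integrable(1)[OF v] sub])
    show "G integrable_on {s..t}" unfolding G_def
      by (intro integrable_add integrable_on_mult_right i1 i2)
    show "0 \<le> G u" for u using l by (simp add: G_def)
    show "q y - q x = integral {x..y} v" if xy: "s \<le> x" "x \<le> y" "y \<le> t" for x y
    proof -
      have "v integrable_on {0..y}"
        by (rule integrable_on_subinterval[OF H1_deriv_integrable(1)[OF v]]) (use xy st in auto)
      then have "integral {0..x} v + integral {x..y} v = integral {0..y} v"
        using xy st by (intro Henstock_Kurzweil_Integration.integral_combine) auto
      moreover have "q x = q 0 + integral {0..x} v" "q y = q 0 + integral {0..y} v"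
        using xy st by (auto intro!: H1_deriv_integral[OF v])
      ultimately show ?thesis by (metis add_diff_cancel_left add_diff_cancel_left')
    qed
    show "norm (v u) \<le> 2 * norm (parabolic (q u)) * G u" if "q u \<noteq> 0" for u
    proof -
      define k where "k = sqrt (norm (q u))"
      have k: "k > 0" "k\<^sup>2 = norm (q u)" using that by (auto simp: k_def)
      \<comment> \<open>AM-GM for l * k * |v| and 2; after division it is |v| / (2 k) \<le> G
        u.\<close>
      have "0 \<le> (l * k * norm (v u) - 2)\<^sup>2" by simp
      then have "4 * (l * k) * norm (v u) \<le> (l * k)\<^sup>2 * (norm (v u))\<^sup>2 + 4"
        by (simp add: power2_eq_square algebra_simps)
      then have "norm (v u) \<le> ((l * k)\<^sup>2 * (norm (v u))\<^sup>2 + 4) / (4 * (l * k))"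
        using l k(1) by (simp add: field_simps)
      also have "\<dots> = 2 * k * G u"
        unfolding G_def k(2)[symmetric] using l k(1) by (simp add: field_simps power2_eq_square)
      finally show ?thesis by (simp add: norm_parabolic k_def)
    qed
  qed (use st i3 in auto)
  also have "integral {s..t} G = l / 2 * integral {s..t} (\<lambda>u. (norm (v u))\<^sup>2 / 4)
      + 1 / (2 * l) * integral {s..t} (\<lambda>u. 1 / norm (q u))"
    unfolding G_def
    by (subst integral_add[OF integrable_on_mult_right[OF i2] integrable_on_mult_right[OF i1]])
       (simp only: integral_mult_right)
  finally show "norm (parabolic (q t) - parabolic (q s))
      \<le> l * integral {s..t} (\<lambda>u. (norm (v u))\<^sup>2 / 4) / 2 + integral {s..t} (\<lambda>u. 1 / norm (q u)) / (2 * l)"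
    by simp
qed simp

section \<open>Symmetrization\<close>

locale finite_action_path =
  fixes T :: real and q v :: "real \<Rightarrow> real \<times> real"
  assumes T_pos: "T > 0" and deriv: "H1_deriv T q v"
    and pot: "(\<lambda>t. 1 / norm (q t)) integrable_on {0..T}"
    and null: "negligible {t \<in> {0..T}. q t = 0}"
begin

text \<open>\<open>\<sigma>\<close> is Levi-Civita time, \<open>a\<close> and \<open>b\<close> are \<open>\<eta>\<^sup>2\<close> and \<open>\<xi>\<^sup>2\<close>, and \<open>G0\<close> below is the integral of
  \<open>\<xi>\<^sup>4 + \<eta>\<^sup>4\<close> with respect to \<open>\<sigma>\<close>. The weight \<open>p\<close> takes the junk value 0 at collisions, which form a null set.\<close>

definition p :: "real \<Rightarrow> real" where "p t = 1 / norm (q t)"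
definition \<sigma> :: "real \<Rightarrow> real" where "\<sigma> t = integral {0..t} p"
definition S :: real where "S = \<sigma> T"
definition a :: "real \<Rightarrow> real" where "a t = (norm (q t) - fst (q t)) / 2"
definition b :: "real \<Rightarrow> real" where "b t = (norm (q t) + fst (q t)) / 2"
definition E :: real where "E = integral {0..T} (\<lambda>t. (norm (v t))\<^sup>2 / 4)"

lemma p_integrable: "p integrable_on {0..T}"
  using pot by (simp add: p_def[abs_def])

lemma p_nonneg: "p t \<ge> 0" by (simp add: p_def)

lemma p_sub: "p integrable_on {s..t}" if "0 \<le> s" "t \<le> T"
  using p_integrable by (rule integrable_on_subinterval) (use that in auto)

lemma q_cont: "continuous_on {0..T} q" by (rule H1_deriv_continuous[OF deriv])

lemma ab_cont: "continuous_on {0..T} a" "continuous_on {0..T} b"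
  unfolding a_def[abs_def] b_def[abs_def] by (auto intro!: continuous_intros q_cont)

lemma ab_nonneg: "a t \<ge> 0" "b t \<ge> 0"
  using abs_fst_le_norm[of "q t"] by (auto simp: a_def b_def)

lemma ab_le: "a t \<le> norm (q t)" "b t \<le> norm (q t)"
  using abs_fst_le_norm[of "q t"] by (auto simp: a_def b_def)

lemma ab_add: "a t + b t = norm (q t)" by (simp add: a_def b_def field_simps)

lemma fp_integrable: "(\<lambda>t. f t * p t) integrable_on {s..t}"
  if f: "continuous_on {0..T} f" and st: "0 \<le> s" "t \<le> T" for f :: "real \<Rightarrow> real"
proof -
  have sub: "{s..t} \<subseteq> {0..T}" using st by auto
  have "(\<lambda>t. f t * p t) absolutely_integrable_on {0..T}"
  proof (rule absolutely_integrable_bounded_measurable_product_real)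
    show "f \<in> borel_measurable (lebesgue_on {0..T})"
      by (intro continuous_imp_measurable_on_sets_lebesgue f) auto
    show "bounded (f ` {0..T})" by (intro compact_imp_bounded compact_continuous_image f) auto
    show "p absolutely_integrable_on {0..T}"
      by (intro nonnegative_absolutely_integrable_1 p_integrable p_nonneg)
  qed auto
  then show ?thesis
    by (intro integrable_on_subinterval[OF _ sub] set_lebesgue_integral_eq_integral(1))
qed

text \<open>This is dt = r ds: the product \<open>norm (q u) * p u\<close> is 1 off the null set of
  collisions.\<close>

lemma integral_norm_p: "integral {s..t} (\<lambda>u. f u * (norm (q u) * p u)) = integral {s..t} f"
  if "0 \<le> s" "t \<le> T" for f :: "real \<Rightarrow> real"
  by (rule integral_spike[OF null]) (use that in \<open>auto simp: p_def\<close>)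

lemma q_bound: "\<exists>M>0. \<forall>t\<in>{0..T}. norm (q t) \<le> M"
proof -
  have "bounded (q ` {0..T})" by (intro compact_imp_bounded compact_continuous_image q_cont) auto
  then show ?thesis by (auto simp: bounded_pos)
qed

lemma sigma_diff: "\<sigma> t - \<sigma> s = integral {s..t} p" if "0 \<le> s" "s \<le> t" "t \<le> T"
  using Henstock_Kurzweil_Integration.integral_combine[of 0 s t p] that p_sub[of 0 t] by (simp add: \<sigma>_def)

text \<open>Almost everywhere p is at least 1 / M. This makes \<sigma> injective and shows that
  cells short in \<sigma> are short in t, where uniform continuity applies.\<close>

lemma sigma_strict: "t - s \<le> M * (\<sigma> t - \<sigma> s)"
  if M: "\<forall>t\<in>{0..T}. norm (q t) \<le> M" and st: "0 \<le> s" "s \<le> t" "t \<le> T"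
proof -
  have "t - s = integral {s..t} (\<lambda>u. 1 * (norm (q u) * p u))"
    using st by (subst integral_norm_p) auto
  also have "\<dots> \<le> integral {s..t} (\<lambda>u. M * p u)"
  proof (rule integral_le)
    show "(\<lambda>u. 1 * (norm (q u) * p u)) integrable_on {s..t}"
      using fp_integrable[of "\<lambda>u. norm (q u)" s t] st by (simp add: continuous_on_norm q_cont)
    show "(\<lambda>u. M * p u) integrable_on {s..t}"
      using st by (intro integrable_on_mult_right p_sub) auto
    show "1 * (norm (q u) * p u) \<le> M * p u" if "u \<in> {s..t}" for u
      using that st M by (auto intro!: mult_right_mono p_nonneg)
  qed
  finally show ?thesis using sigma_diff[OF st] by simp
qed

lemma S_pos: "S > 0"
proof -
  obtain M where M: "M > 0" "\<forall>t\<in>{0..T}. norm (q t) \<le> M" using q_bound by blast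
  have "T - 0 \<le> M * (\<sigma> T - \<sigma> 0)" using T_pos by (intro sigma_strict M) auto
  then have "0 < M * S" using T_pos by (simp add: S_def \<sigma>_def)
  then show ?thesis using M by (simp add: zero_less_mult_iff)
qed

lemma sigma_inj: "s = t" if "s \<in> {0..T}" "t \<in> {0..T}" "\<sigma> s = \<sigma> t"
proof -
  obtain M where M: "M > 0" "\<forall>t\<in>{0..T}. norm (q t) \<le> M" using q_bound by blast
  have "t - s \<le> 0" if "s \<le> t"
    using sigma_strict[OF M(2), of s t] \<open>s \<in> {0..T}\<close> \<open>t \<in> {0..T}\<close> that unfolding \<open>\<sigma> s = \<sigma> t\<close> by simp
  moreover have "s - t \<le> 0" if "t \<le> s"
    using sigma_strict[OF M(2), of t s] \<open>s \<in> {0..T}\<close> \<open>t \<in> {0..T}\<close> that unfolding \<open>\<sigma> s = \<sigma> t\<close> by simp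
  ultimately show ?thesis by linarith
qed

lemma sigma_mono: "\<sigma> s \<le> \<sigma> t" if "0 \<le> s" "s \<le> t" "t \<le> T"
  using sigma_diff[OF that] integral_nonneg[OF p_sub[of s t]] that p_nonneg by simp

text \<open>The steps are equal in \<sigma> rather than in t, so that reversing Levi-Civita time
  maps cells to cells of the same length.\<close>

lemma grid_exists:
  assumes N: "N > 0"
  obtains \<tau> :: "nat \<Rightarrow> real" where "\<tau> 0 = 0" "\<tau> N = T"
    "\<And>i. i \<le> N \<Longrightarrow> \<tau> i \<in> {0..T}" "\<And>i. i < N \<Longrightarrow> \<tau> i \<le> \<tau> (Suc i)"
    "\<And>i. i < N \<Longrightarrow> integral {\<tau> i..\<tau> (Suc i)} p = S / N"
proof -
  have \<sigma>0: "\<sigma> 0 = 0" by (simp add: \<sigma>_def)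
  have cont: "continuous_on {0..T} \<sigma>"
    unfolding \<sigma>_def[abs_def] by (rule indefinite_integral_continuous_1[OF p_integrable])
  have "\<exists>t. i \<le> N \<longrightarrow> t \<in> {0..T} \<and> \<sigma> t = i * S / N" for i
  proof (cases "i \<le> N")
    case True
    have "\<exists>t\<ge>0. t \<le> T \<and> \<sigma> t = i * S / N"
    proof (rule IVT')
      show "\<sigma> 0 \<le> i * S / N" using S_pos by (simp add: \<sigma>0)
      show "i * S / N \<le> \<sigma> T" using S_pos True N by (simp add: S_def[symmetric] field_simps)
    qed (use T_pos cont in auto)
    then show ?thesis by auto
  qed auto
  then obtain \<tau> where \<tau>: "\<And>i. i \<le> N \<Longrightarrow> \<tau> i \<in> {0..T}" "\<And>i. i \<le> N \<Longrightarrow> \<sigma> (\<tau> i) = i * S / N"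
    by metis
  have mono: "\<tau> i \<le> \<tau> (Suc i)" if "i < N" for i
  proof (rule ccontr)
    assume "\<not> \<tau> i \<le> \<tau> (Suc i)"
    then have "\<sigma> (\<tau> (Suc i)) \<le> \<sigma> (\<tau> i)" using \<tau>(1)[of i] \<tau>(1)[of "Suc i"] that by (intro sigma_mono) auto
    moreover have "real i * S / N < real (Suc i) * S / N"
      using S_pos N by (intro divide_strict_right_mono mult_strict_right_mono) auto
    ultimately show False using \<tau>(2)[of i] \<tau>(2)[of "Suc i"] that by simp
  qed
  show ?thesis
  proof
    show "\<tau> 0 = 0" using \<tau>[of 0] \<sigma>0 T_pos by - (rule sigma_inj, auto)
    show "\<tau> N = T" using \<tau>[of N] T_pos N by - (rule sigma_inj, auto simp: S_def)
    show "integral {\<tau> i..\<tau> (Suc i)} p = S / N" if "i < N" for i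
      using sigma_diff[of "\<tau> i" "\<tau> (Suc i)"] mono[OF that] \<tau>[of i] \<tau>[of "Suc i"] that N
      by (simp add: field_simps)
  qed (use \<tau> mono in auto)
qed

lemma sum_cells: "(\<Sum>i<N. integral {\<tau> i..\<tau> (Suc i)} f) = integral {0..T} f"
  if \<tau>: "\<tau> 0 = 0" "\<tau> N = T" "\<And>i. i \<le> N \<Longrightarrow> \<tau> i \<in> {0..T}" "\<And>i. i < N \<Longrightarrow> \<tau> i \<le> \<tau> (Suc i)"
    and f: "f integrable_on {0..T}" for f :: "real \<Rightarrow> real"
proof -
  have "n \<le> N \<Longrightarrow> (\<Sum>i<n. integral {\<tau> i..\<tau> (Suc i)} f) = integral {0..\<tau> n} f" for n
  proof (induction n)
    case (Suc n)
    have "f integrable_on {0..\<tau> (Suc n)}"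
      using f by (rule integrable_on_subinterval) (use \<tau>(3)[of "Suc n"] Suc.prems in auto)
    then have "integral {0..\<tau> n} f + integral {\<tau> n..\<tau> (Suc n)} f = integral {0..\<tau> (Suc n)} f"
      using \<tau>(3)[of n] \<tau>(4)[of n] Suc.prems by (intro Henstock_Kurzweil_Integration.integral_combine) auto
    then show ?case using Suc by simp
  qed (simp add: \<tau>)
  from this[of N] show ?thesis by (simp add: \<tau>)
qed

text \<open>One-sided, with cell values F that need not be values of f; estimates from the other
  side come from negated functions.\<close>

lemma Riemann_sum_le:
  fixes f :: "real \<Rightarrow> real" and F :: "nat \<Rightarrow> real"
  assumes \<tau>: "\<tau> 0 = 0" "\<tau> N = T" "\<And>i. i \<le> N \<Longrightarrow> \<tau> i \<in> {0..T}" "\<And>i. i < N \<Longrightarrow> \<tau> i \<le> \<tau> (Suc i)"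
    and cell: "\<And>i. i < N \<Longrightarrow> integral {\<tau> i..\<tau> (Suc i)} p = D"
    and f: "continuous_on {0..T} f"
    and F: "\<And>i t. i < N \<Longrightarrow> t \<in> {\<tau> i..\<tau> (Suc i)} \<Longrightarrow> F i \<le> f t + k"
  shows "D * (\<Sum>i<N. F i) \<le> integral {0..T} (\<lambda>t. f t * p t) + k * S"
proof -
  have fk: "continuous_on {0..T} (\<lambda>t. f t + k)" by (intro continuous_intros f)
  have "D * (\<Sum>i<N. F i) = (\<Sum>i<N. integral {\<tau> i..\<tau> (Suc i)} (\<lambda>t. F i * p t))"
    by (simp add: sum_distrib_left cell mult.commute)
  also have "\<dots> \<le> (\<Sum>i<N. integral {\<tau> i..\<tau> (Suc i)} (\<lambda>t. (f t + k) * p t))"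
  proof (rule sum_mono)
    fix i assume i: "i \<in> {..<N}"
    then show "integral {\<tau> i..\<tau> (Suc i)} (\<lambda>t. F i * p t) \<le> integral {\<tau> i..\<tau> (Suc i)} (\<lambda>t. (f t + k) * p t)"
      using \<tau>(3)[of i] \<tau>(3)[of "Suc i"] F
      by (intro integral_le integrable_on_mult_right p_sub fp_integrable fk mult_right_mono p_nonneg) auto
  qed
  also have "\<dots> = integral {0..T} (\<lambda>t. (f t + k) * p t)"
    by (intro sum_cells \<tau> fp_integrable fk) auto
  also have "\<dots> = integral {0..T} (\<lambda>t. f t * p t + k * p t)" by (simp add: algebra_simps)
  also have "\<dots> = integral {0..T} (\<lambda>t. f t * p t) + k * S"
    by (subst integral_add) (auto intro!: fp_integrable f p_integrable integrable_on_mult_right simp: S_def \<sigma>_def)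
  finally show ?thesis .
qed

end

section \<open>The symmetrized polygon and its errors\<close>

text \<open>Corrects the duration of a polygon to T. Scaling the nodes by sqrt c with D fixed
  multiplies time and kinetic term by c, the fourth powers by c^2, and leaves the potential term N *
  D alone.\<close>

lemma radial_polygon_rescaled:
  fixes h :: "nat \<Rightarrow> real" and D :: real
  assumes D: "D > 0" and N: "N > 0" and T: "T > 0" and h0: "h 0 = 0" and h: "\<And>i. i > 0 \<Longrightarrow> h i > 0"
  defines "c \<equiv> T / (\<Sum>i<N. D * ((h i)\<^sup>2 + h i * h (Suc i) + (h (Suc i))\<^sup>2) / 3)"
  shows "c > 0"
    and "\<exists>r v. radial T r v \<and> radial_action T r v \<le>
      c * (2 * (\<Sum>i<N. (h (Suc i) - h i)\<^sup>2) / D) + N * D - c\<^sup>2 * (D * (\<Sum>i<N. (min (h i) (h (Suc i))) ^ 4))"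
proof -
  define \<theta> where "\<theta> = (\<Sum>i<N. D * ((h i)\<^sup>2 + h i * h (Suc i) + (h (Suc i))\<^sup>2) / 3)"
  have h_nonneg: "h i \<ge> 0" for i using h[of i] h0 by (cases "i = 0") auto
  have pos: "D * ((h i)\<^sup>2 + h i * h (Suc i) + (h (Suc i))\<^sup>2) / 3 > 0" for i
    using D h_nonneg[of i] h[of "Suc i"] by (simp add: add_nonneg_pos)
  have \<theta>: "\<theta> > 0" unfolding \<theta>_def using N pos by (intro sum_pos) auto
  then show c: "c > 0" using T by (simp add: c_def \<theta>_def)
  have c\<theta>: "c * \<theta> = T" using \<theta> by (simp add: c_def \<theta>_def[symmetric])
  define k where "k = (\<lambda>i. sqrt c * h i)"
  have sq: "sqrt c * sqrt c = c" "(sqrt c)\<^sup>2 = c" using c by auto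
  have "T = (\<Sum>i<N. D * ((k i)\<^sup>2 + k i * k (Suc i) + (k (Suc i))\<^sup>2) / 3)"
  proof -
    have "D * ((k i)\<^sup>2 + k i * k (Suc i) + (k (Suc i))\<^sup>2) / 3
        = c * (D * ((h i)\<^sup>2 + h i * h (Suc i) + (h (Suc i))\<^sup>2) / 3)" for i
    proof -
      have "k i * k (Suc i) = c * (h i * h (Suc i))"
        using sq(1) by (simp add: k_def mult.assoc mult.left_commute)
      then show ?thesis by (simp add: k_def power_mult_distrib sq algebra_simps)
    qed
    then show ?thesis by (simp only: c\<theta>[symmetric] \<theta>_def sum_distrib_left)
  qed
  moreover have "k 0 = 0" "\<And>i. i > 0 \<Longrightarrow> k i > 0" using h0 h c by (auto simp: k_def)
  ultimately obtain r v where rv: "radial T r v" and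
    le: "radial_action T r v \<le> 2 * (\<Sum>i<N. (k (Suc i) - k i)\<^sup>2) / D + N * D - D * (\<Sum>i<N. (min (k i) (k (Suc i))) ^ 4)"
    using radial_polygon[OF D N, of k T] by blast
  have "(k (Suc i) - k i)\<^sup>2 = c * (h (Suc i) - h i)\<^sup>2" for i
    by (simp add: k_def right_diff_distrib[symmetric] power_mult_distrib sq)
  moreover have "(min (k i) (k (Suc i))) ^ 4 = c\<^sup>2 * (min (h i) (h (Suc i))) ^ 4" for i
  proof -
    have "min (k i) (k (Suc i)) = sqrt c * min (h i) (h (Suc i))"
      unfolding k_def using c by (simp add: min_mult_distrib_left)
    moreover have "sqrt c ^ 4 = c\<^sup>2" using sq(2) by (simp add: power4_eq_xxxx power2_eq_square)
    ultimately show ?thesis by (simp add: power_mult_distrib)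
  qed
  ultimately show "\<exists>r v. radial T r v \<and> radial_action T r v \<le>
      c * (2 * (\<Sum>i<N. (h (Suc i) - h i)\<^sup>2) / D) + N * D - c\<^sup>2 * (D * (\<Sum>i<N. (min (h i) (h (Suc i))) ^ 4))"
    using rv le by (intro exI[of _ r] exI[of _ v]) (simp add: sum_distrib_left algebra_simps)
qed

context finite_action_path
begin

lemma ab_parabolic: "a t = (snd (parabolic (q t)))\<^sup>2" "b t = (fst (parabolic (q t)))\<^sup>2"
  by (simp_all add: a_def b_def parabolic_squares)

definition G0 :: real where
  "G0 = integral {0..T} (\<lambda>t. (a t)\<^sup>2 * p t) + integral {0..T} (\<lambda>t. (b t)\<^sup>2 * p t)"

text \<open>The error 3 * e * S in the duration is e * S each for the oscillation of a, that of b,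
  and the extra summand in R; the latter also costs 2 * e / S in the kinetic term. The squares of a
  and of b lose 2 * M * e * S each.\<close>

lemma symmetrized_polygon:
  assumes a0: "a 0 = 0" and bT: "b T = 0" and M: "M > 0" "\<forall>t\<in>{0..T}. norm (q t) \<le> M"
    and e: "e > 0" "3 * e * S < T"
  shows "\<exists>r w c. radial T r w \<and> T / (T + 3 * e * S) \<le> c \<and> c \<le> T / (T - 3 * e * S) \<and>
    radial_action T r w \<le> c * (2 * E + 2 * e / S) + S - c\<^sup>2 * (G0 - 4 * M * e * S)"
proof -
  have "uniformly_continuous_on {0..T} a" "uniformly_continuous_on {0..T} b"
    by (intro compact_uniformly_continuous ab_cont compact_Icc)+
  from this[unfolded uniformly_continuous_on_def, rule_format, OF e(1)]
  obtain d1 d2 where d1: "d1 > 0" "\<And>s t. s \<in> {0..T} \<Longrightarrow> t \<in> {0..T} \<Longrightarrow> dist s t < d1 \<Longrightarrow> dist (a s) (a t) < e"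
    and d2: "d2 > 0" "\<And>s t. s \<in> {0..T} \<Longrightarrow> t \<in> {0..T} \<Longrightarrow> dist s t < d2 \<Longrightarrow> dist (b s) (b t) < e"
    by blast
  define d where "d = min d1 d2"
  have d: "d > 0" using d1 d2 by (simp add: d_def)
  \<comment> \<open>Fine enough that a cell, of \<sigma>-length S / N, is shorter than d in time
    t.\<close>
  obtain N :: nat where N': "M * S / d < N" using reals_Archimedean2 by blast
  have "M * S / d > 0" using M S_pos d by simp
  with N' have N: "N > 0" by (auto intro!: gr0I)
  define D where "D = S / N"
  have D: "D > 0" "N * D = S" using S_pos N by (auto simp: D_def)
  have MD: "M * D < d" using N' N d by (simp add: D_def field_simps)
  obtain \<tau> where \<tau>: "\<tau> 0 = 0" "\<tau> N = T" "\<And>i. i \<le> N \<Longrightarrow> \<tau> i \<in> {0..T}" "\<And>i. i < N \<Longrightarrow> \<tau> i \<le> \<tau> (Suc i)"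
    and cell: "\<And>i. i < N \<Longrightarrow> integral {\<tau> i..\<tau> (Suc i)} p = D"
    using grid_exists[OF N] unfolding D_def by blast
  have close: "\<bar>a s - a t\<bar> < e \<and> \<bar>b s - b t\<bar> < e"
    if "i < N" "s \<in> {\<tau> i..\<tau> (Suc i)}" "t \<in> {\<tau> i..\<tau> (Suc i)}" for i s t
  proof -
    have "\<tau> (Suc i) - \<tau> i \<le> M * (\<sigma> (\<tau> (Suc i)) - \<sigma> (\<tau> i))"
      using \<tau>(3)[of i] \<tau>(3)[of "Suc i"] \<tau>(4)[of i] that by (intro sigma_strict M) auto
    also have "\<dots> = M * D"
      using sigma_diff[of "\<tau> i" "\<tau> (Suc i)"] \<tau>(3)[of i] \<tau>(3)[of "Suc i"] \<tau>(4)[of i] that cell[of i] by simp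
    finally have "dist s t < d" using that MD by (auto simp: dist_real_def)
    moreover have "s \<in> {0..T}" "t \<in> {0..T}" using \<tau>(3)[of i] \<tau>(3)[of "Suc i"] that by auto
    ultimately show ?thesis using d1(2)[of s t] d2(2)[of s t] by (simp add: d_def dist_real_def)
  qed
  define \<eta> \<xi> where "\<eta> = (\<lambda>i. snd (parabolic (q (\<tau> i))))" and "\<xi> = (\<lambda>i. fst (parabolic (q (\<tau> i))))"
  have \<eta>_sq: "(\<eta> i)\<^sup>2 = a (\<tau> i)" and \<xi>_sq: "(\<xi> i)\<^sup>2 = b (\<tau> i)" for i
    by (simp_all add: \<eta>_def \<xi>_def ab_parabolic)
  \<comment> \<open>The last summand only serves to keep the competitor away from interior collisions.\<close>
  define R where "R = (\<lambda>i. a (\<tau> i) + b (\<tau> (N - i)) + e * (real i / N)\<^sup>2)"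
  define h where "h = (\<lambda>i. if i = 0 then 0 else sqrt (R i))"
  have R_pos: "R i > 0" if "i > 0" for i
    using that N e ab_nonneg by (auto simp: R_def intro!: add_nonneg_pos)
  have R0: "R 0 = 0" using a0 bT \<tau> by (simp add: R_def)
  have R_nonneg: "R i \<ge> 0" for i using R_pos[of i] R0 by (cases "i = 0") auto
  have h_sq: "(h i)\<^sup>2 = R i" and h_nonneg: "h i \<ge> 0" and h_sqrt: "h i = sqrt (R i)" for i
    using R_nonneg[of i] R0 by (auto simp: h_def)
  have h_pos: "h i > 0" if "i > 0" for i using that R_pos by (simp add: h_def)
  have h0: "h 0 = 0" by (simp add: h_def)
  \<comment> \<open>Viewed as the length of this vector, h has increments bounded by those of the
    vector, by the reverse triangle inequality.\<close>
  have norm_h: "h i = norm (\<eta> i, \<xi> (N - i), sqrt e * (real i / N))" for i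
  proof -
    have "(sqrt e * (real i / N))\<^sup>2 = e * (real i / N)\<^sup>2" using e by (simp only: power_mult_distrib) simp
    moreover have "0 \<le> b (\<tau> (N - i)) + e * (real i / N)\<^sup>2" using ab_nonneg e by simp
    ultimately show ?thesis
      by (simp add: norm_prod_def h_sqrt R_def \<eta>_sq \<xi>_sq del: times_divide_eq_right)
  qed
  have dh: "(h (Suc i) - h i)\<^sup>2 \<le> (\<eta> (Suc i) - \<eta> i)\<^sup>2 + (\<xi> (Suc (N - Suc i)) - \<xi> (N - Suc i))\<^sup>2 + e / (real N)\<^sup>2"
    if "i < N" for i
  proof -
    \<comment> \<open>Step i of the reversed coordinate runs backwards through cell N - Suc i, not N
      - i.\<close>
    have *: "N - i = Suc (N - Suc i)" using that by simp
    have "\<bar>h (Suc i) - h i\<bar> \<le> norm ((\<eta> (Suc i), \<xi> (N - Suc i), sqrt e * (real (Suc i) / N)) - (\<eta> i, \<xi> (N - i), sqrt e * (real i / N)))"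
      unfolding norm_h by (rule norm_triangle_ineq3)
    then have "(h (Suc i) - h i)\<^sup>2 \<le> (norm ((\<eta> (Suc i), \<xi> (N - Suc i), sqrt e * (real (Suc i) / N)) - (\<eta> i, \<xi> (N - i), sqrt e * (real i / N))))\<^sup>2"
      by (metis abs_le_square_iff abs_norm_cancel)
    also have "\<dots> = (\<eta> (Suc i) - \<eta> i)\<^sup>2 + ((\<xi> (N - Suc i) - \<xi> (N - i))\<^sup>2 + (sqrt e * (real (Suc i) / N) - sqrt e * (real i / N))\<^sup>2)"
      by (simp add: norm_prod_def)
    also have "(\<xi> (N - Suc i) - \<xi> (N - i))\<^sup>2 = (\<xi> (Suc (N - Suc i)) - \<xi> (N - Suc i))\<^sup>2"
      unfolding * by (rule power2_commute)
    also have "sqrt e * (real (Suc i) / N) - sqrt e * (real i / N) = sqrt e / N"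
      by (simp add: algebra_simps add_divide_distrib)
    also have "(sqrt e / N)\<^sup>2 = e / (real N)\<^sup>2" using e by (simp add: power_divide)
    finally show ?thesis by simp
  qed
  have kin: "2 * (\<Sum>i<N. (h (Suc i) - h i)\<^sup>2) / D \<le> 2 * E + 2 * e / S"
  proof -
    have "(\<Sum>i<N. (h (Suc i) - h i)\<^sup>2) \<le> (\<Sum>i<N. (\<eta> (Suc i) - \<eta> i)\<^sup>2 + (\<xi> (Suc (N - Suc i)) - \<xi> (N - Suc i))\<^sup>2 + e / (real N)\<^sup>2)"
      by (intro sum_mono dh) simp
    also have "\<dots> = (\<Sum>i<N. (\<eta> (Suc i) - \<eta> i)\<^sup>2) + (\<Sum>i<N. (\<xi> (Suc (N - Suc i)) - \<xi> (N - Suc i))\<^sup>2) + N * (e / (real N)\<^sup>2)"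
      by (simp add: sum.distrib)
    also have "(\<Sum>i<N. (\<xi> (Suc (N - Suc i)) - \<xi> (N - Suc i))\<^sup>2) = (\<Sum>i<N. (\<xi> (Suc i) - \<xi> i)\<^sup>2)"
      by (rule sum.nat_diff_reindex)
    also have "(\<Sum>i<N. (\<eta> (Suc i) - \<eta> i)\<^sup>2) + (\<Sum>i<N. (\<xi> (Suc i) - \<xi> i)\<^sup>2)
        = (\<Sum>i<N. (norm (parabolic (q (\<tau> (Suc i))) - parabolic (q (\<tau> i))))\<^sup>2)"
      by (simp add: sum.distrib[symmetric] norm_prod_def \<eta>_def \<xi>_def add.commute)
    also have "\<dots> \<le> (\<Sum>i<N. D * integral {\<tau> i..\<tau> (Suc i)} (\<lambda>t. (norm (v t))\<^sup>2 / 4))"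
    proof (rule sum_mono)
      fix i assume i: "i \<in> {..<N}"
      then show "(norm (parabolic (q (\<tau> (Suc i))) - parabolic (q (\<tau> i))))\<^sup>2 \<le> D * integral {\<tau> i..\<tau> (Suc i)} (\<lambda>t. (norm (v t))\<^sup>2 / 4)"
        using parabolic_energy_bound[OF deriv pot, of "\<tau> i" "\<tau> (Suc i)"] \<tau>(3)[of i] \<tau>(3)[of "Suc i"] \<tau>(4)[of i]
          cell[of i, unfolded p_def] by simp
    qed
    also have "\<dots> = D * E"
      unfolding sum_distrib_left[symmetric] E_def
      by (subst sum_cells) (use \<tau> H1_deriv_integrable(2)[OF deriv] in \<open>auto intro: integrable_on_divide\<close>)
    finally have "(\<Sum>i<N. (h (Suc i) - h i)\<^sup>2) \<le> D * E + e / N"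
      using N by (simp add: power2_eq_square)
    then have "2 * (\<Sum>i<N. (h (Suc i) - h i)\<^sup>2) / D \<le> 2 * (D * E + e / N) / D"
      using D by (intro divide_right_mono mult_left_mono) auto
    also have "\<dots> = 2 * E + 2 * e / S"
      using D(1) N S_pos by (simp add: D_def field_simps)
    finally show ?thesis .
  qed
  define amin amax bmin bmax where
    "amin = (\<lambda>i. min (a (\<tau> i)) (a (\<tau> (Suc i))))" and "amax = (\<lambda>i. max (a (\<tau> i)) (a (\<tau> (Suc i))))" and
    "bmin = (\<lambda>i. min (b (\<tau> i)) (b (\<tau> (Suc i))))" and "bmax = (\<lambda>i. max (b (\<tau> i)) (b (\<tau> (Suc i))))"
  have osc: "a t \<le> amin i + e \<and> amax i \<le> a t + e \<and> b t \<le> bmin i + e \<and> bmax i \<le> b t + e"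
    if "i < N" "t \<in> {\<tau> i..\<tau> (Suc i)}" for i t
    using close[OF that(1), of t "\<tau> i"] close[OF that(1), of t "\<tau> (Suc i)"] that \<tau>(4)[of i]
    unfolding amin_def amax_def bmin_def bmax_def by auto
  have min_nonneg: "amin i \<ge> 0" "bmin i \<ge> 0" for i using ab_nonneg by (auto simp: amin_def bmin_def)
  have R_lower: "amin i + bmin (N - Suc i) \<le> R i \<and> amin i + bmin (N - Suc i) \<le> R (Suc i)"
    and R_upper: "R i \<le> amax i + bmax (N - Suc i) + e \<and> R (Suc i) \<le> amax i + bmax (N - Suc i) + e"
    if "i < N" for i
  proof -
    have *: "Suc (N - Suc i) = N - i" using that by simp
    define x y where "x = e * (real i / N)\<^sup>2" and "y = e * (real (Suc i) / N)\<^sup>2"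
    have "x \<le> e * 1" "y \<le> e * 1"
      unfolding x_def y_def using that e N by (intro mult_left_mono power_le_one; simp)+
    moreover have "0 \<le> x" "0 \<le> y" using e by (auto simp: x_def y_def)
    ultimately show "amin i + bmin (N - Suc i) \<le> R i \<and> amin i + bmin (N - Suc i) \<le> R (Suc i)"
      "R i \<le> amax i + bmax (N - Suc i) + e \<and> R (Suc i) \<le> amax i + bmax (N - Suc i) + e"
      unfolding R_def amin_def amax_def bmin_def bmax_def * x_def[symmetric] y_def[symmetric] by auto
  qed
  \<comment> \<open>The expression is the mean of a squared linear function running from h i to h
    (Suc i), hence between the squared end values.\<close>
  have h_mid: "min (R i) (R (Suc i)) \<le> ((h i)\<^sup>2 + h i * h (Suc i) + (h (Suc i))\<^sup>2) / 3 \<and>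
      ((h i)\<^sup>2 + h i * h (Suc i) + (h (Suc i))\<^sup>2) / 3 \<le> max (R i) (R (Suc i))" for i
  proof -
    have "(min (h i) (h (Suc i)))\<^sup>2 \<le> h i * h (Suc i)" "h i * h (Suc i) \<le> (max (h i) (h (Suc i)))\<^sup>2"
      unfolding power2_eq_square using h_nonneg[of i] h_nonneg[of "Suc i"] by (intro mult_mono; auto)+
    moreover have "(min (h i) (h (Suc i)))\<^sup>2 = min (R i) (R (Suc i))" "(max (h i) (h (Suc i)))\<^sup>2 = max (R i) (R (Suc i))"
      using h_nonneg[of i] h_nonneg[of "Suc i"] power_mono[of "h i" "h (Suc i)" 2] power_mono[of "h (Suc i)" "h i" 2]
      by (auto simp: min_def max_def h_sq[symmetric])
    ultimately show ?thesis unfolding h_sq by (auto simp: min_def max_def)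
  qed
  have mid: "amin i + bmin (N - Suc i) \<le> ((h i)\<^sup>2 + h i * h (Suc i) + (h (Suc i))\<^sup>2) / 3 \<and>
      ((h i)\<^sup>2 + h i * h (Suc i) + (h (Suc i))\<^sup>2) / 3 \<le> amax i + bmax (N - Suc i) + e" if "i < N" for i
    using h_mid[of i] R_lower[OF that] R_upper[OF that] by linarith
  define \<theta> where "\<theta> = (\<Sum>i<N. D * ((h i)\<^sup>2 + h i * h (Suc i) + (h (Suc i))\<^sup>2) / 3)"
  have \<theta>_eq: "\<theta> = D * (\<Sum>i<N. ((h i)\<^sup>2 + h i * h (Suc i) + (h (Suc i))\<^sup>2) / 3)"
    unfolding \<theta>_def sum_distrib_left by (rule sum.cong) auto
  have int_ab: "integral {0..T} (\<lambda>t. a t * p t) + integral {0..T} (\<lambda>t. b t * p t) = T"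
  proof -
    have "integral {0..T} (\<lambda>t. a t * p t) + integral {0..T} (\<lambda>t. b t * p t) = integral {0..T} (\<lambda>t. a t * p t + b t * p t)"
      by (intro integral_add[symmetric] fp_integrable ab_cont) auto
    also have "\<dots> = integral {0..T} (\<lambda>t. 1 * (norm (q t) * p t))"
      by (simp add: ab_add[symmetric] algebra_simps)
    also have "\<dots> = T" by (subst integral_norm_p) (use T_pos in auto)
    finally show ?thesis .
  qed
  have \<theta>_le: "\<theta> \<le> T + 3 * e * S"
  proof -
    have "\<theta> \<le> D * (\<Sum>i<N. amax i + bmax (N - Suc i) + e)"
      unfolding \<theta>_eq by (intro mult_left_mono sum_mono) (use mid D(1) in \<open>auto simp del: divide_le_eq_numeral1\<close>)
    also have "\<dots> = D * (\<Sum>i<N. amax i) + D * (\<Sum>i<N. bmax (N - Suc i)) + e * (N * D)"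
      by (simp add: sum.distrib algebra_simps)
    also have "(\<Sum>i<N. bmax (N - Suc i)) = (\<Sum>i<N. bmax i)" by (rule sum.nat_diff_reindex)
    also have "D * (\<Sum>i<N. amax i) + D * (\<Sum>i<N. bmax i) + e * (N * D)
        \<le> (integral {0..T} (\<lambda>t. a t * p t) + e * S) + (integral {0..T} (\<lambda>t. b t * p t) + e * S) + e * S"
      unfolding D(2) using osc by (intro add_mono Riemann_sum_le[OF \<tau> cell] ab_cont) auto
    also have "\<dots> = T + 3 * e * S" using int_ab by simp
    finally show ?thesis .
  qed
  have \<theta>_ge: "T - 3 * e * S \<le> \<theta>"
  proof -
    have "D * (\<Sum>i<N. - amin i) + D * (\<Sum>i<N. - bmin i)
       \<le> (integral {0..T} (\<lambda>t. - a t * p t) + e * S) + (integral {0..T} (\<lambda>t. - b t * p t) + e * S)"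
    proof (intro add_mono Riemann_sum_le[OF \<tau> cell])
      show "- amin i \<le> - a t + e" "- bmin i \<le> - b t + e" if "i < N" "t \<in> {\<tau> i..\<tau> (Suc i)}" for i t
        using osc[OF that] by auto
    qed (auto intro!: continuous_intros ab_cont)
    then have "T - 2 * e * S \<le> D * (\<Sum>i<N. amin i) + D * (\<Sum>i<N. bmin i)"
      using int_ab by (simp add: sum_negf)
    also have "(\<Sum>i<N. bmin i) = (\<Sum>i<N. bmin (N - Suc i))" by (rule sum.nat_diff_reindex[symmetric])
    also have "D * (\<Sum>i<N. amin i) + D * (\<Sum>i<N. bmin (N - Suc i)) = D * (\<Sum>i<N. amin i + bmin (N - Suc i))"
      by (simp add: sum.distrib algebra_simps)
    also have "\<dots> \<le> \<theta>"
      unfolding \<theta>_eq by (intro mult_left_mono sum_mono) (use mid D(1) in \<open>auto simp del: le_divide_eq_numeral1\<close>)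
    finally show ?thesis using mult_pos_pos[OF e(1) S_pos] by simp
  qed
  have G: "G0 - 4 * M * e * S \<le> D * (\<Sum>i<N. (min (h i) (h (Suc i))) ^ 4)"
  proof -
    \<comment> \<open>In x^2 - m^2 = (x - m) (x + m) the factors are at most e and 2 * M.\<close>
    have sq_osc: "- (m\<^sup>2) \<le> - (x\<^sup>2) + 2 * M * e" if "x \<le> m + e" "0 \<le> m" "m \<le> M" "0 \<le> x" "x \<le> M" for x m
    proof (cases "x \<le> m")
      case True
      then have "x\<^sup>2 \<le> m\<^sup>2" using that by (intro power_mono)
      moreover have "0 \<le> 2 * M * e" using M e by simp
      ultimately show ?thesis by linarith
    next
      case False
      have "x\<^sup>2 - m\<^sup>2 = (x - m) * (x + m)" by (simp add: power2_eq_square algebra_simps)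
      also have "\<dots> \<le> e * (2 * M)" using that False by (intro mult_mono) auto
      finally show ?thesis by (simp add: algebra_simps)
    qed
    have bnd: "a t \<le> M" "b t \<le> M" if "t \<in> {0..T}" for t
      using ab_le[of t] M(2) that by (meson order_trans)+
    have bnd_min: "amin i \<le> M" "bmin i \<le> M" if "i < N" for i
      using bnd[OF \<tau>(3), of i] that by (auto simp: amin_def bmin_def)
    have "D * (\<Sum>i<N. - (amin i)\<^sup>2) + D * (\<Sum>i<N. - (bmin i)\<^sup>2)
       \<le> (integral {0..T} (\<lambda>t. - (a t)\<^sup>2 * p t) + 2 * M * e * S) + (integral {0..T} (\<lambda>t. - (b t)\<^sup>2 * p t) + 2 * M * e * S)"
    proof (intro add_mono Riemann_sum_le[OF \<tau> cell])
      show "- (amin i)\<^sup>2 \<le> - (a t)\<^sup>2 + 2 * M * e" "- (bmin i)\<^sup>2 \<le> - (b t)\<^sup>2 + 2 * M * e"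
        if "i < N" "t \<in> {\<tau> i..\<tau> (Suc i)}" for i t
      proof -
        have t: "t \<in> {0..T}" using that \<tau>(3)[of i] \<tau>(3)[of "Suc i"] by auto
        show "- (amin i)\<^sup>2 \<le> - (a t)\<^sup>2 + 2 * M * e" "- (bmin i)\<^sup>2 \<le> - (b t)\<^sup>2 + 2 * M * e"
          by (rule sq_osc; use osc[OF that] that(1) t in \<open>simp add: min_nonneg bnd bnd_min ab_nonneg\<close>)+
      qed
    qed (auto intro!: continuous_intros ab_cont)
    then have "G0 - 4 * M * e * S \<le> D * (\<Sum>i<N. (amin i)\<^sup>2) + D * (\<Sum>i<N. (bmin i)\<^sup>2)"
      by (simp add: sum_negf G0_def)
    also have "(\<Sum>i<N. (bmin i)\<^sup>2) = (\<Sum>i<N. (bmin (N - Suc i))\<^sup>2)" by (rule sum.nat_diff_reindex[symmetric])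
    also have "D * (\<Sum>i<N. (amin i)\<^sup>2) + D * (\<Sum>i<N. (bmin (N - Suc i))\<^sup>2) = D * (\<Sum>i<N. (amin i)\<^sup>2 + (bmin (N - Suc i))\<^sup>2)"
      by (simp add: sum.distrib algebra_simps)
    also have "\<dots> \<le> D * (\<Sum>i<N. (min (h i) (h (Suc i))) ^ 4)"
    proof (intro mult_left_mono sum_mono)
      fix i assume "i \<in> {..<N}"
      then have i: "i < N" by simp
      \<comment> \<open>Dropping the nonnegative cross term is what reverses the sign of the \<xi>
        contribution.\<close>
      have "(amin i)\<^sup>2 + (bmin (N - Suc i))\<^sup>2 \<le> (amin i + bmin (N - Suc i))\<^sup>2"
        using min_nonneg by (simp add: power2_sum)
      also have "\<dots> \<le> ((min (h i) (h (Suc i)))\<^sup>2)\<^sup>2"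
        using R_lower[OF i] min_nonneg by (intro power_mono add_nonneg_nonneg) (auto simp: min_def h_sq)
      finally show "(amin i)\<^sup>2 + (bmin (N - Suc i))\<^sup>2 \<le> (min (h i) (h (Suc i))) ^ 4" by simp
    qed (use D in auto)
    finally show ?thesis .
  qed
  define c where "c = T / \<theta>"
  have c_pos: "c > 0"
    and ex: "\<exists>r w. radial T r w \<and> radial_action T r w \<le>
      c * (2 * (\<Sum>i<N. (h (Suc i) - h i)\<^sup>2) / D) + N * D - c\<^sup>2 * (D * (\<Sum>i<N. (min (h i) (h (Suc i))) ^ 4))"
    using radial_polygon_rescaled[where h=h, OF D(1) N T_pos h0 h_pos] unfolding c_def \<theta>_def by auto
  have c: "T / (T + 3 * e * S) \<le> c" "c \<le> T / (T - 3 * e * S)"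
    unfolding c_def using \<theta>_le \<theta>_ge e T_pos by (auto intro!: divide_left_mono mult_pos_pos)
  from ex obtain r w where rw: "radial T r w" "radial_action T r w \<le>
      c * (2 * (\<Sum>i<N. (h (Suc i) - h i)\<^sup>2) / D) + N * D - c\<^sup>2 * (D * (\<Sum>i<N. (min (h i) (h (Suc i))) ^ 4))"
    by blast
  note rw(2)
  also have "\<dots> \<le> c * (2 * E + 2 * e / S) + S - c\<^sup>2 * (G0 - 4 * M * e * S)"
    unfolding D(2) using kin G c_pos by (intro diff_mono add_mono mult_left_mono) auto
  finally show ?thesis using rw(1) c by blast
qed

end

section \<open>Passage to the limit and vanishing of \<xi>\<close>

context finite_action_path
begin

text \<open>The bound m does not depend on e, so letting e tend to 0 in the bounds of
  \<open>symmetrized_polygon\<close> suffices, without a limiting competitor.\<close>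

lemma radial_infimum_le:
  assumes a0: "a 0 = 0" and bT: "b T = 0"
    and m: "\<And>r w. radial T r w \<Longrightarrow> m \<le> radial_action T r w"
  shows "m \<le> 2 * E + S - G0"
proof -
  obtain M where M: "M > 0" "\<forall>t\<in>{0..T}. norm (q t) \<le> M" using q_bound by blast
  define K where "K = (\<lambda>e. T / (T - 3 * e * S))"
  define k where "k = (\<lambda>e. T / (T + 3 * e * S))"
  \<comment> \<open>The unknown scale c is replaced by K e in terms that increase the bound and by k
    e in the one that lowers it; E and G0 are nonnegative.\<close>
  define f where "f = (\<lambda>e. K e * (2 * E + 2 * e / S) + S - (k e)\<^sup>2 * G0 + (K e)\<^sup>2 * (4 * M * e * S))"
  have E: "E \<ge> 0" unfolding E_def
    by (intro integral_nonneg integrable_on_divide H1_deriv_integrable(2)[OF deriv]) auto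
  have G0: "G0 \<ge> 0" unfolding G0_def
    by (intro add_nonneg_nonneg integral_nonneg fp_integrable continuous_intros ab_cont) (auto simp: p_nonneg)
  have "m \<le> f e" if e: "e > 0" "e < T / (3 * S)" for e
  proof -
    have eS: "3 * e * S < T" using e S_pos by (simp add: field_simps)
    obtain r w c where rw: "radial T r w" and c: "k e \<le> c" "c \<le> K e"
      and le: "radial_action T r w \<le> c * (2 * E + 2 * e / S) + S - c\<^sup>2 * (G0 - 4 * M * e * S)"
      using symmetrized_polygon[OF a0 bT M e(1) eS] unfolding k_def K_def by blast
    have k: "k e \<ge> 0" using T_pos S_pos e by (simp add: k_def)
    have "c * (2 * E + 2 * e / S) \<le> K e * (2 * E + 2 * e / S)"
      using c E e S_pos by (intro mult_right_mono) auto
    moreover have "(k e)\<^sup>2 * G0 \<le> c\<^sup>2 * G0"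
      using c k G0 by (intro mult_right_mono power_mono) auto
    moreover have "c\<^sup>2 * (4 * M * e * S) \<le> (K e)\<^sup>2 * (4 * M * e * S)"
      using c k e M S_pos by (intro mult_right_mono power_mono) auto
    ultimately have "radial_action T r w \<le> f e" using le by (simp add: f_def algebra_simps)
    then show ?thesis using m[OF rw] by simp
  qed
  moreover have "(f \<longlongrightarrow> T / (T - 3 * 0 * S) * (2 * E + 2 * 0 / S) + S - (T / (T + 3 * 0 * S))\<^sup>2 * G0
      + (T / (T - 3 * 0 * S))\<^sup>2 * (4 * M * 0 * S)) (at_right 0)"
    unfolding f_def K_def k_def using T_pos S_pos by (intro tendsto_intros) auto
  moreover have "eventually (\<lambda>e. m \<le> f e) (at_right 0)"
    using calculation(1) T_pos S_pos
    by (subst eventually_at_right[of 0 1]) (auto intro!: exI[of _ "T / (3 * S)"])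
  ultimately show ?thesis
    using T_pos by (intro tendsto_lowerbound[of f _ "at_right 0" m]) auto
qed

text \<open>The action is 2 * E + S plus the integral of b^2 p minus that of a^2 p, while the
  infimum is at most the same with b^2 p subtracted. So twice the integral of b^2 p is at most
  0.\<close>

lemma b_zero_if_le_radial:
  assumes a0: "a 0 = 0" and bT: "b T = 0"
    and m: "\<And>r w. radial T r w \<Longrightarrow> integral {0..T} (\<lambda>t. (norm (v t))\<^sup>2 / 2)
           + integral {0..T} (\<lambda>t. 1 / norm (q t)) + integral {0..T} (\<lambda>t. fst (q t)) \<le> radial_action T r w"
    and t: "t \<in> {0..T}"
  shows "b t = 0"
proof -
  have "integral {0..T} (\<lambda>t. (norm (v t))\<^sup>2 / 2) = integral {0..T} (\<lambda>t. 2 * ((norm (v t))\<^sup>2 / 4))"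
    by simp
  also have "\<dots> = 2 * E" unfolding E_def by (rule integral_mult_right)
  finally have kin: "integral {0..T} (\<lambda>t. (norm (v t))\<^sup>2 / 2) = 2 * E" .
  have int_sq: "(\<lambda>t. (a t)\<^sup>2 * p t) integrable_on {0..T}" "(\<lambda>t. (b t)\<^sup>2 * p t) integrable_on {0..T}"
    by (auto intro!: fp_integrable continuous_intros ab_cont)
  have x: "integral {0..T} (\<lambda>t. fst (q t)) = integral {0..T} (\<lambda>t. (b t)\<^sup>2 * p t) - integral {0..T} (\<lambda>t. (a t)\<^sup>2 * p t)"
  proof -
    have "fst (q t) * (norm (q t) * p t) = (b t)\<^sup>2 * p t - (a t)\<^sup>2 * p t" for t
      by (simp add: a_def b_def power2_eq_square field_simps)
    then have "integral {0..T} (\<lambda>t. fst (q t) * (norm (q t) * p t)) = integral {0..T} (\<lambda>t. (b t)\<^sup>2 * p t - (a t)\<^sup>2 * p t)"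
      by simp
    then show ?thesis using int_sq by (simp add: integral_diff integral_norm_p)
  qed
  have "2 * E + S + integral {0..T} (\<lambda>t. fst (q t)) \<le> 2 * E + S - G0"
    using m unfolding kin S_def \<sigma>_def p_def
    by (intro radial_infimum_le[OF a0 bT, unfolded S_def \<sigma>_def p_def])
  then have b_le: "integral {0..T} (\<lambda>t. (b t)\<^sup>2 * p t) \<le> 0" by (simp add: x G0_def)
  obtain M where M: "M > 0" "\<forall>t\<in>{0..T}. norm (q t) \<le> M" using q_bound by blast
  \<comment> \<open>Bounding norm (q t) by M removes the weight p, discontinuous at collisions; b^2
    alone is continuous, so a zero integral gives zero at every point.\<close>
  have "integral {0..T} (\<lambda>t. (b t)\<^sup>2) = integral {0..T} (\<lambda>t. (b t)\<^sup>2 * (norm (q t) * p t))"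
    by (rule integral_norm_p[symmetric]) auto
  also have "\<dots> \<le> integral {0..T} (\<lambda>t. M * ((b t)\<^sup>2 * p t))"
  proof (rule integral_le)
    have "(\<lambda>t. ((b t)\<^sup>2 * norm (q t)) * p t) integrable_on {0..T}"
      by (intro fp_integrable continuous_intros ab_cont q_cont) auto
    then show "(\<lambda>t. (b t)\<^sup>2 * (norm (q t) * p t)) integrable_on {0..T}" by (simp add: mult.assoc)
    show "(\<lambda>t. M * ((b t)\<^sup>2 * p t)) integrable_on {0..T}" by (intro integrable_on_mult_right int_sq)
    fix t assume "t \<in> {0..T}"
    then have "norm (q t) * ((b t)\<^sup>2 * p t) \<le> M * ((b t)\<^sup>2 * p t)"
      using M p_nonneg by (intro mult_right_mono) auto
    then show "(b t)\<^sup>2 * (norm (q t) * p t) \<le> M * ((b t)\<^sup>2 * p t)" by (simp add: mult.left_commute)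
  qed
  also have "\<dots> \<le> 0" using b_le M by (simp add: mult_le_0_iff)
  finally have "integral {0..T} (\<lambda>t. (b t)\<^sup>2) \<le> 0" .
  moreover have "0 \<le> integral {0..T} (\<lambda>t. (b t)\<^sup>2)"
    by (intro integral_nonneg integrable_continuous_real continuous_intros ab_cont) auto
  ultimately have "integral {0..T} (\<lambda>t. (b t)\<^sup>2) = 0" by simp
  then have "\<forall>t\<in>{0..T}. (b t)\<^sup>2 = 0"
    using T_pos by (subst (asm) integral_eq_0_iff) (auto intro!: continuous_intros ab_cont)
  then show ?thesis using t by simp
qed

end

text \<open>Supplies one competitor of finite action, so the action of a minimizer is
  finite.\<close>

lemma exists_radial:
  assumes "T > 0"
  shows "\<exists>r v. radial T r v"
  using radial_polygon_rescaled(2)[of 1 1 T "\<lambda>i. real i"] assms by auto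

lemma minimizer_on_axis:
  assumes T: "T > 0" and min: "global_minimizer T q"
  shows "action T q < \<infinity>" and "q 0 = 0"
    and "\<And>t. t \<in> {0..T} \<Longrightarrow> snd (q t) = 0 \<and> fst (q t) \<le> 0"
proof -
  obtain r w where "radial T r w" using exists_radial[OF T] by blast
  then have "action T q \<le> ereal (radial_action T r w)"
    by (rule minimizer_le_radial[OF min _ T])
  then show fin: "action T q < \<infinity>" by (auto simp: less_top[symmetric])
  obtain v where v: "H1_deriv T q v"
    using min by (auto simp: global_minimizer_def Omega_def H1_def)
  have fin': "action_with T q v < \<infinity>" using fin action_eq_action_with[OF v T] by simp
  note int = action_finite_imp_integrable[OF v fin']
  obtain N where ae: "\<And>t. t \<in> space lborel - N \<Longrightarrow> t \<in> {0..T} \<longrightarrow> q t \<noteq> 0" and N: "N \<in> null_sets lborel"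
    using AE_E3[OF int(2)] by blast
  have sub: "{t \<in> {0..T}. q t = 0} \<subseteq> N" using ae by auto
  have "negligible N" using N by (simp add: negligible_iff_null_sets null_sets_completionI)
  then have "negligible {t \<in> {0..T}. q t = 0}" using sub negligible_subset by blast
  then interpret finite_action_path T q v
    using T v set_borel_integral_eq_integral(1)[OF int(1)] by unfold_locales auto
  have bd: "snd (q 0) = 0" "snd (q T) = 0" "fst (q 0) \<ge> 0" "fst (q T) \<le> 0"
    using min by (auto simp: global_minimizer_def Omega_def)
  \<comment> \<open>In parabolic coordinates the two boundary conditions say that \<eta> vanishes at
    time 0 and \<xi> at time T.\<close>
  have a0: "a 0 = 0" using bd by (simp add: a_def norm_prod_def)
  have bT: "b T = 0" using bd by (simp add: b_def norm_prod_def)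
  have b0: "b t = 0" if "t \<in> {0..T}" for t
  proof (rule b_zero_if_le_radial[OF a0 bT _ that])
    fix r w assume "radial T r w"
    then have "action T q \<le> ereal (radial_action T r w)"
      by (rule minimizer_le_radial[OF min _ T])
    then show "integral {0..T} (\<lambda>t. (norm (v t))\<^sup>2 / 2) + integral {0..T} (\<lambda>t. 1 / norm (q t))
        + integral {0..T} (\<lambda>t. fst (q t)) \<le> radial_action T r w"
      using action_eq_action_with[OF v T] action_with_eq_integral[OF v int] by simp
  qed
  show axis: "snd (q t) = 0 \<and> fst (q t) \<le> 0" if "t \<in> {0..T}" for t
  proof -
    have eq: "norm (q t) = - fst (q t)" using b0[OF that] by (simp add: b_def)
    then have "fst (q t) \<le> 0" using norm_ge_zero[of "q t"] by linarith
    moreover have "(fst (q t))\<^sup>2 + (snd (q t))\<^sup>2 = (fst (q t))\<^sup>2"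
      using arg_cong[OF eq, of "\<lambda>x. x\<^sup>2"] by (simp add: norm_prod_def)
    ultimately show ?thesis by simp
  qed
  show "q 0 = 0" using axis[of 0] bd T by (simp add: prod_eq_iff)
qed

section \<open>Monotonicity on the axis\<close>

lemma radial_continuous:
  assumes "radial T r v"
  shows "continuous_on {0..T} r"
proof -
  have "v integrable_on {0..T}" using radialD(1)[OF assms] by (rule set_borel_integral_eq_integral)
  then have "continuous_on {0..T} (\<lambda>t. integral {0..t} v)" by (rule indefinite_integral_continuous_1)
  then show ?thesis by (rule continuous_on_eq) (rule radialD(4)[OF assms, symmetric])
qed

lemma radial_increment:
  assumes "radial T r v" "0 \<le> s" "s \<le> t" "t \<le> T"
  shows "integral {s..t} v = r t - r s"
proof -
  have "v integrable_on {0..T}" using radialD(1)[OF assms(1)] by (rule set_borel_integral_eq_integral)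
  then have "v integrable_on {0..t}" by (rule integrable_on_subinterval) (use assms in auto)
  then show ?thesis
    using Henstock_Kurzweil_Integration.integral_combine[of 0 s t v] assms
      radialD(4)[OF assms(1), of s] radialD(4)[OF assms(1), of t] by simp
qed

text \<open>A competitor above a positive multiple of r inherits from r the integrability of the
  potential and the null collision set.\<close>

lemma radialI_ge:
  assumes rad: "radial T r v"
    and w: "set_integrable lborel {0..T} w" "set_integrable lborel {0..T} (\<lambda>t. (w t)\<^sup>2)"
    and R: "\<And>t. t \<in> {0..T} \<Longrightarrow> R t = integral {0..t} w"
    and k: "k > 0" "\<And>t. t \<in> {0..T} \<Longrightarrow> k * r t \<le> R t"
  shows "radial T R w"
proof -
  have "w integrable_on {0..T}" using w(1) by (rule set_borel_integral_eq_integral)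
  then have "continuous_on {0..T} (\<lambda>t. integral {0..t} w)" by (rule indefinite_integral_continuous_1)
  then have cont: "continuous_on {0..T} R" by (rule continuous_on_eq) (rule R[symmetric])
  have nonneg: "R t \<ge> 0" if "t \<in> {0..T}" for t
    using mult_nonneg_nonneg[OF less_imp_le[OF k(1)] radialD(5)[OF rad that]] k(2)[OF that] by linarith
  have pos: "R t > 0" if "t \<in> {0..T}" "r t \<noteq> 0" for t
  proof -
    have "0 < r t" using radialD(5)[OF rad that(1)] that(2) by linarith
    then show ?thesis using mult_pos_pos[OF k(1), of "r t"] k(2)[OF that(1)] by linarith
  qed
  have int: "set_integrable lborel {0..T} (\<lambda>t. 1 / R t)"
  proof (rule set_integrable_bound)
    show "set_integrable lborel {0..T} (\<lambda>t. 1 / k * (1 / r t))"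
      using radialD(3)[OF rad] by (rule set_integrable_mult_right)
    have "(\<lambda>t. 1 / (indicator {0..T} t *\<^sub>R R t)) \<in> borel_measurable borel"
      by (intro borel_measurable_divide borel_measurable_const borel_measurable_continuous_on_indicator cont) auto
    moreover have "(\<lambda>t. indicat_real {0..T} t *\<^sub>R (1 / R t)) = (\<lambda>t. 1 / (indicator {0..T} t *\<^sub>R R t))"
      by (auto simp: indicator_def)
    ultimately show "set_borel_measurable lborel {0..T} (\<lambda>t. 1 / R t)"
      unfolding set_borel_measurable_def by simp
    show "AE t in lborel. t \<in> {0..T} \<longrightarrow> norm (1 / R t) \<le> norm (1 / k * (1 / r t))"
      using radialD(6)[OF rad]
    proof eventually_elim
      case (elim t)
      show ?case
      proof
        assume t: "t \<in> {0..T}"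
        have "0 < r t" using elim t radialD(5)[OF rad t] by (simp add: order_less_le)
        then have "1 / R t \<le> 1 / (k * r t)"
          using k(1) k(2)[OF t] pos[OF t] by (intro divide_left_mono mult_pos_pos) auto
        then show "norm (1 / R t) \<le> norm (1 / k * (1 / r t))"
          using nonneg[OF t] k(1) \<open>0 < r t\<close> by simp
      qed
    qed
  qed
  have "AE t in lborel. t \<in> {0..T} \<longrightarrow> R t \<noteq> 0"
    using radialD(6)[OF rad]
  proof eventually_elim
    case (elim t)
    then show ?case using pos[of t] by auto
  qed
  then show ?thesis
    unfolding radial_def by (intro conjI ballI w int nonneg R)
qed

lemma set_integrable_indicator_mult:
  fixes f :: "real \<Rightarrow> real"
  assumes "set_integrable lborel A f" "B \<in> sets borel"
  shows "set_integrable lborel A (\<lambda>t. indicator B t * f t)"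
proof -
  have "integrable lborel (\<lambda>t. indicator B t *\<^sub>R (indicator A t *\<^sub>R f t))"
    by (rule integrable_mult_indicator) (use assms in \<open>auto simp: set_integrable_def\<close>)
  then show ?thesis by (simp add: set_integrable_def mult.left_commute)
qed

lemma integral_indicator_mult:
  fixes f :: "real \<Rightarrow> real"
  shows "integral A (\<lambda>t. indicator B t * f t) = integral (A \<inter> B) f"
proof -
  have "(\<lambda>t. indicator B t * f t) = (\<lambda>t. if t \<in> B then f t else 0)"
    by (auto simp: indicator_def)
  then show ?thesis by (simp only: integral_restrict_Int Int_commute)
qed

locale radial_minimizer =
  fixes T :: real and r v :: "real \<Rightarrow> real"
  assumes T_pos: "T > 0" and rad: "radial T r v"
    and minimal: "\<And>s w. radial T s w \<Longrightarrow> radial_action T r v \<le> radial_action T s w"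
begin

lemma r_cont: "continuous_on {0..T} r" by (rule radial_continuous[OF rad])

lemma r_nonneg: "t \<in> {0..T} \<Longrightarrow> r t \<ge> 0" by (rule radialD(5)[OF rad])

text \<open>Replacing an excursion of \<open>r\<close> below an earlier value by that constant value lowers all three
  terms of the action.\<close>

lemma no_excursion:
  assumes st: "0 \<le> s" "s < u" "u < t \<or> u = T \<and> t = T" "t \<le> T"
    and below: "\<And>x. x \<in> {s..t} \<Longrightarrow> r x \<le> r s" and strict: "r u < r s"
    and ret: "t < T \<Longrightarrow> r t = r s"
  shows False
proof -
  define w where "w = (\<lambda>x. indicator (- {s..t}) x * v x)"
  define R where "R = (\<lambda>x. if x \<in> {s..t} then r s else r x)"
  have stT: "s < t" "u \<in> {0..T}" "u \<in> {s..t}" using st by auto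
  have iv: "v integrable_on {0..T}" "(\<lambda>x. (v x)\<^sup>2) integrable_on {0..T}"
    using radialD(1,2)[OF rad] by (auto intro: set_borel_integral_eq_integral)
  have w1: "set_integrable lborel {0..T} w"
    unfolding w_def by (intro set_integrable_indicator_mult radialD(1)[OF rad]) auto
  have wsq: "(\<lambda>x. (w x)\<^sup>2) = (\<lambda>x. indicator (- {s..t}) x * (v x)\<^sup>2)"
    by (auto simp: w_def indicator_def)
  have w2: "set_integrable lborel {0..T} (\<lambda>x. (w x)\<^sup>2)"
    unfolding wsq by (intro set_integrable_indicator_mult radialD(2)[OF rad]) auto
  have Rw: "R x = integral {0..x} w" if x: "x \<in> {0..T}" for x
  proof -
    have vx: "v integrable_on {0..x}" by (rule integrable_on_subinterval[OF iv(1)]) (use x in auto)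
    have ii: "(\<lambda>y. indicator {s..t} y * v y) integrable_on {0..x}"
    proof -
      have "set_integrable lborel {0..x} v"
        by (rule set_integrable_subset[OF radialD(1)[OF rad]]) (use x in auto)
      then have "set_integrable lborel {0..x} (\<lambda>y. indicator {s..t} y * v y)"
        by (intro set_integrable_indicator_mult) auto
      then show ?thesis by (rule set_borel_integral_eq_integral)
    qed
    have "integral {0..x} w = integral {0..x} (\<lambda>y. v y - indicator {s..t} y * v y)"
      by (intro integral_cong) (auto simp: w_def indicator_def)
    also have "\<dots> = r x - integral ({0..x} \<inter> {s..t}) v"
      using integral_diff[OF vx ii] radialD(4)[OF rad x] by (simp add: integral_indicator_mult)
    also have "{0..x} \<inter> {s..t} = {s..min x t}" using st by auto
    also have "r x - integral {s..min x t} v = R x"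
    proof (cases "x < s")
      case True
      then show ?thesis by (simp add: R_def)
    next
      case False
      then have *: "integral {s..min x t} v = r (min x t) - r s"
        using st stT x by (intro radial_increment[OF rad]) auto
      show ?thesis
      proof (cases "x \<le> t")
        case True
        then show ?thesis using False * by (simp add: R_def)
      next
        case not: False
        \<comment> \<open>Past a time t < T the deleted increment is r t - r s = 0, so R rejoins r;
          for t = T there is no such x.\<close>
        then have "r t = r s" using x by (intro ret) auto
        then show ?thesis using False not * by (simp add: R_def)
      qed
    qed
    finally show ?thesis by simp
  qed
  have rR: "r x \<le> R x" for x using below by (simp add: R_def)
  have R: "radial T R w"
    by (rule radialI_ge[OF rad w1 w2 Rw, of 1]) (use rR in auto)
  have "integral {0..T} (\<lambda>x. (w x)\<^sup>2 / 2) \<le> integral {0..T} (\<lambda>x. (v x)\<^sup>2 / 2)"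
    using iv(2) set_borel_integral_eq_integral(1)[OF w2]
    by (intro integral_le integrable_on_divide) (auto simp: w_def indicator_def)
  moreover have "integral {0..T} (\<lambda>x. 1 / R x) \<le> integral {0..T} (\<lambda>x. 1 / r x)"
  proof -
    have "(LINT x:{0..T}|lborel. 1 / R x) \<le> (LINT x:{0..T}|lborel. 1 / r x)"
    proof (rule set_integral_mono_AE[OF radialD(3)[OF R] radialD(3)[OF rad]])
      show "AE x\<in>{0..T} in lborel. 1 / R x \<le> 1 / r x"
        using radialD(6)[OF rad]
      proof eventually_elim
        case (elim x)
        show ?case
        proof
          assume x: "x \<in> {0..T}"
          then have "0 < r x" using elim r_nonneg[OF x] by (simp add: order_less_le)
          then show "1 / R x \<le> 1 / r x" using rR[of x] by (intro divide_left_mono mult_pos_pos) auto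
        qed
      qed
    qed
    then show ?thesis
      using set_borel_integral_eq_integral(2)[OF radialD(3)[OF R]] set_borel_integral_eq_integral(2)[OF radialD(3)[OF rad]]
      by simp
  qed
  moreover have "integral {0..T} r < integral {0..T} R"
  proof -
    note cont = r_cont radial_continuous[OF R]
    \<comment> \<open>By continuity one point with r u < R u makes the last term of the action
      strictly smaller.\<close>
    have "R u - r u \<noteq> 0" using strict stT by (simp add: R_def)
    then have "integral {0..T} (\<lambda>x. R x - r x) \<noteq> 0"
      using stT(2) rR T_pos by (subst integral_eq_0_iff) (auto intro!: continuous_intros cont)
    moreover have "integral {0..T} (\<lambda>x. R x - r x) \<ge> 0"
      using rR by (intro integral_nonneg integrable_continuous_real continuous_intros cont) auto
    moreover have "integral {0..T} (\<lambda>x. R x - r x) = integral {0..T} R - integral {0..T} r"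
      by (intro integral_diff integrable_continuous_real cont)
    ultimately show ?thesis by simp
  qed
  ultimately have "radial_action T R w < radial_action T r v" by (simp add: radial_action_def)
  then show False using minimal[OF R] by simp
qed

text \<open>If r y < r x, let s be the last time before y and t the first time after y at which r
  reaches the level r x, or t = T if it never returns. Between them is a forbidden
  excursion.\<close>

lemma r_mono:
  assumes xy: "0 \<le> x" "x \<le> y" "y \<le> T"
  shows "r x \<le> r y"
proof (rule ccontr)
  assume "\<not> r x \<le> r y"
  then have less: "r y < r x" by simp
  define A where "A = {z \<in> {x..y}. r x \<le> r z}"
  have sub: "{x..y} \<subseteq> {0..T}" "{y..T} \<subseteq> {0..T}" using xy by auto
  have cont: "continuous_on {x..y} r" "continuous_on {y..T} r"
    using continuous_on_subset[OF r_cont] sub by auto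
  have level: "compact {z \<in> {c..d}. r x \<le> r z}" if "continuous_on {c..d} r" for c d
  proof -
    have "closed ({c..d} \<inter> r -` {r x..})"
      by (rule continuous_closed_preimage[OF that]) auto
    moreover have "{z \<in> {c..d}. r x \<le> r z} = {c..d} \<inter> r -` {r x..}" by auto
    moreover have "bounded {z \<in> {c..d}. r x \<le> r z}"
      by (rule bounded_subset[OF bounded_closed_interval[of c d]]) auto
    ultimately show ?thesis by (simp add: compact_eq_bounded_closed)
  qed
  have "compact A" unfolding A_def by (rule level[OF cont(1)])
  moreover have "x \<in> A" using xy by (simp add: A_def)
  ultimately obtain s where s: "s \<in> A" "\<And>z. z \<in> A \<Longrightarrow> z \<le> s"
    using compact_attains_sup[of A] by blast
  have s_bd: "x \<le> s" "s < y" "r x \<le> r s" using s(1) less by (auto simp: A_def order_less_le)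
  have rs: "r s = r x"
  proof -
    have "\<exists>z\<ge>s. z \<le> y \<and> r z = r x"
      using s_bd less by (intro IVT2' continuous_on_subset[OF cont(1)]) auto
    then obtain z where z: "s \<le> z" "z \<le> y" "r z = r x" by blast
    then have "z \<in> A" using s_bd by (simp add: A_def)
    then show ?thesis using s(2)[of z] z by simp
  qed
  have after: "r z < r x" if "s < z" "z \<le> y" for z
  proof (rule ccontr)
    assume "\<not> r z < r x"
    then have "z \<in> A" using that s_bd by (simp add: A_def)
    then show False using s(2)[of z] that by simp
  qed
  define B where "B = {z \<in> {y..T}. r x \<le> r z}"
  have "compact B" unfolding B_def by (rule level[OF cont(2)])
  show False
  proof (cases "B = {}")
    case True
    have late: "r z < r x" if "y \<le> z" "z \<le> T" for z
    proof (rule ccontr)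
      assume "\<not> r z < r x"
      then have "z \<in> B" using that by (simp add: B_def)
      then show False using True by simp
    qed
    have "r z \<le> r s" if "z \<in> {s..T}" for z
      using after[of z] late[of z] that rs by (cases "z = s"; cases "z \<le> y") auto
    then show False
      using no_excursion[of s y T] s_bd xy less rs by (cases "y = T") auto
  next
    case False
    then obtain t where t: "t \<in> B" "\<And>z. z \<in> B \<Longrightarrow> t \<le> z"
      using compact_attains_inf[OF \<open>compact B\<close>] by blast
    have t_bd: "y < t" "t \<le> T" "r x \<le> r t" using t(1) less by (auto simp: B_def order_less_le)
    have rt: "r t = r x"
    proof -
      have "\<exists>z\<ge>y. z \<le> t \<and> r z = r x"
        using t_bd less by (intro IVT' continuous_on_subset[OF cont(2)]) auto
      then obtain z where z: "y \<le> z" "z \<le> t" "r z = r x" by blast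
      then have "z \<in> B" using t_bd by (simp add: B_def)
      then show ?thesis using t(2)[of z] z by simp
    qed
    have "r z \<le> r s" if "z \<in> {s..t}" for z
    proof (rule ccontr)
      assume *: "\<not> r z \<le> r s"
      then have "y < z" using after[of z] that rs by (cases "z = s"; cases "z \<le> y") auto
      then have "z \<in> B" using * rs that t_bd by (simp add: B_def)
      then show False using t(2)[of z] that rt rs * by (cases "z = t") auto
    qed
    then show False
      using no_excursion[of s y t] s_bd t_bd xy less rs rt by auto
  qed
qed

text \<open>By monotonicity a zero at time t would make r vanish on all of {0..t}, which is not a
  null set.\<close>

lemma r_pos: "r t > 0" if t: "0 < t" "t \<le> T"
proof (rule ccontr)
  assume "\<not> 0 < r t"
  then have "r u = 0" if "u \<in> {0..t}" for u
    using r_mono[of u t] r_nonneg[of u] that t by auto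
  moreover obtain N where ae: "\<And>u. u \<in> space lborel - N \<Longrightarrow> u \<in> {0..T} \<longrightarrow> r u \<noteq> 0"
    and N: "N \<in> null_sets lborel"
    using AE_E3[OF radialD(6)[OF rad]] by blast
  ultimately have "{0..t} \<subseteq> N" using t by force
  then have "emeasure lborel {0..t} \<le> emeasure lborel N"
    using N by (intro emeasure_mono) auto
  then show False using N t by (simp add: null_setsD1)
qed

end

section \<open>The Euler--Lagrange equation\<close>

text \<open>The first-order condition: for small e of either sign the linear term would beat the
  quadratic one.\<close>

lemma zero_if_quadratic_nonneg:
  fixes x C k :: real
  assumes k: "k > 0" and C: "C \<ge> 0" and le: "\<And>e. \<bar>e\<bar> \<le> k \<Longrightarrow> 0 \<le> e * x + e\<^sup>2 * C"
  shows "x = 0"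
proof (rule ccontr)
  assume "x \<noteq> 0"
  \<comment> \<open>Small enough that t * C < |x|, because C / (2 (C + 1)) < 1.\<close>
  define t where "t = min k (\<bar>x\<bar> / (2 * (C + 1)))"
  have t: "t > 0" "t \<le> k" using k C \<open>x \<noteq> 0\<close> by (auto simp: t_def)
  have "0 \<le> t * (t * C + x)" "0 \<le> t * (t * C - x)"
    using le[of t] le[of "-t"] t by (auto simp: power2_eq_square algebra_simps simp del: zero_le_mult_iff)
  then have "\<bar>x\<bar> \<le> t * C" using t by (simp add: zero_le_mult_iff abs_le_iff)
  also have "\<dots> \<le> \<bar>x\<bar> / (2 * (C + 1)) * C" using C by (intro mult_right_mono) (auto simp: t_def)
  also have "\<dots> < \<bar>x\<bar>" using C \<open>x \<noteq> 0\<close> by (simp add: field_simps add_nonneg_pos)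
  finally show False by simp
qed

context radial_minimizer
begin

text \<open>The pull towards the origin: for r the equation of motion is r'' = - g. Then P is the
  candidate for r', normalized by r'(T) = 0.\<close>

definition g :: "real \<Rightarrow> real" where "g t = 1 / (r t)\<^sup>2 + 1"
definition P :: "real \<Rightarrow> real" where "P t = integral {t..T} g"

lemma cont_r: "continuous_on {x..T} r" if "0 < x"
  by (rule continuous_on_subset[OF r_cont]) (use that in auto)

lemma cont_g: "continuous_on {x..T} g" if "0 < x"
  unfolding g_def[abs_def]
proof (intro continuous_intros cont_r that)
  show "\<forall>t\<in>{x..T}. (r t)\<^sup>2 \<noteq> 0"
  proof
    fix t assume "t \<in> {x..T}"
    then have "0 < r t" using that by (intro r_pos) auto
    then show "(r t)\<^sup>2 \<noteq> 0" by simp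
  qed
qed

lemma g_nonneg: "g t \<ge> 0" by (simp add: g_def)

text \<open>First variation along the ramp \<psi>, which is 0 up to a, linear on {a..b} and 1
  afterwards. The kinetic term contributes the mean slope of r on {a..b}, the other two terms the
  weighted integral of g.\<close>

lemma slope_eq:
  assumes ab: "0 < a" "a < b" "b \<le> T"
  shows "(r b - r a) / (b - a) = integral {a..T} (\<lambda>t. (min t b - a) / (b - a) * g t)"
proof -
  define d where "d = b - a"
  define \<rho> where "\<rho> = r a"
  define \<psi> where "\<psi> = (\<lambda>t. (max a (min t b) - a) / d)"
  have d: "d > 0" using ab by (simp add: d_def)
  have \<rho>: "\<rho> > 0" using ab r_pos[of a] by (simp add: \<rho>_def)
  have \<psi>01: "0 \<le> \<psi> t" "\<psi> t \<le> 1" for t using ab d by (auto simp: \<psi>_def d_def)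
  have \<psi>0: "\<psi> t = 0" if "t \<le> a" for t using that by (simp add: \<psi>_def)
  have \<psi>_cont: "continuous_on A \<psi>" for A unfolding \<psi>_def using d by (intro continuous_intros) auto
  have r_ge: "\<rho> \<le> r t" if "t \<in> {a..T}" for t
    using r_mono[of a t] ab that by (simp add: \<rho>_def)
  have sub: "{a..T} \<subseteq> {0..T}" and cap: "{0..T} \<inter> {a..b} = {a..b}" using ab by auto
  define s where "s = (r b - r a) / d"
  define I where "I = integral {a..T} (\<lambda>t. \<psi> t * g t)"
  \<comment> \<open>1 / (2 * d) is the kinetic energy of the ramp; 2 * T / \<rho> ^ 3 bounds the
    second-order remainder of the potential.\<close>
  define C where "C = 1 / (2 * d) + 2 * T / \<rho> ^ 3"
  have inv_cont: "continuous_on {a..T} (\<lambda>t. \<psi> t / (r t)\<^sup>2)"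
    using r_ge \<rho> by (intro continuous_intros \<psi>_cont cont_r ab) force
  have split: "integral {0..T} f = integral {a..T} f"
    if f: "f integrable_on {0..T}" and z: "\<And>t. t \<in> {0..a} \<Longrightarrow> f t = 0" for f :: "real \<Rightarrow> real"
  proof -
    have "integral {0..a} f + integral {a..T} f = integral {0..T} f"
      using ab by (intro Henstock_Kurzweil_Integration.integral_combine f) auto
    moreover have "integral {0..a} f = integral {0..a} (\<lambda>t. 0)" by (intro integral_cong z)
    ultimately show ?thesis by simp
  qed
  have I_eq: "I = integral {a..T} (\<lambda>t. \<psi> t / (r t)\<^sup>2) + integral {0..T} \<psi>"
  proof -
    have "I = integral {a..T} (\<lambda>t. \<psi> t / (r t)\<^sup>2 + \<psi> t)"
      by (simp add: I_def g_def algebra_simps)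
    also have "\<dots> = integral {a..T} (\<lambda>t. \<psi> t / (r t)\<^sup>2) + integral {a..T} \<psi>"
      by (intro integral_add integrable_continuous_real inv_cont \<psi>_cont)
    also have "integral {a..T} \<psi> = integral {0..T} \<psi>"
      by (rule split[symmetric]) (auto intro: integrable_continuous_real \<psi>_cont \<psi>0)
    finally show ?thesis .
  qed
  have "s - I = 0"
  proof (rule zero_if_quadratic_nonneg[of "\<rho> / 2" C])
    show "C \<ge> 0" using d T_pos \<rho> by (simp add: C_def)
    \<comment> \<open>This range keeps R above r / 2, so that \<open>radialI_ge\<close> applies, and
      above \<rho> / 2 on {a..T}.\<close>
    fix e :: real assume e: "\<bar>e\<bar> \<le> \<rho> / 2"
    define w where "w = (\<lambda>t. v t + e / d * indicator {a..b} t)"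
    define R where "R = (\<lambda>t. r t + e * \<psi> t)"
    note v1 = radialD(1)[OF rad] and v2 = radialD(2)[OF rad]
    have ind: "set_integrable lborel {0..T} (\<lambda>t. indicator {a..b} t * c)" for c :: real
      by (intro set_integrable_indicator_mult borel_integrable_atLeastAtMost' continuous_intros) auto
    have indv: "set_integrable lborel {0..T} (\<lambda>t. indicator {a..b} t * (2 * e / d * v t))"
      by (intro set_integrable_indicator_mult set_integrable_mult_right v1) auto
    have w1: "set_integrable lborel {0..T} w"
      unfolding w_def using ind[of "e / d"] by (intro set_integral_add v1) (simp add: mult.commute)
    have wsq: "(w t)\<^sup>2 = (v t)\<^sup>2 + (indicator {a..b} t * (2 * e / d * v t) + indicator {a..b} t * (e / d)\<^sup>2)" for t
      by (simp add: w_def indicator_def power2_eq_square algebra_simps)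
    have w2: "set_integrable lborel {0..T} (\<lambda>t. (w t)\<^sup>2)"
      unfolding wsq by (intro set_integral_add v2 indv ind)
    have kin: "integral {0..T} (\<lambda>t. (w t)\<^sup>2 / 2) = integral {0..T} (\<lambda>t. (v t)\<^sup>2 / 2) + e * s + e\<^sup>2 / (2 * d)"
    proof -
      note hk = set_borel_integral_eq_integral(1)
      have "integral {0..T} (\<lambda>t. (w t)\<^sup>2) = integral {0..T} (\<lambda>t. (v t)\<^sup>2)
          + (integral {0..T} (\<lambda>t. indicator {a..b} t * (2 * e / d * v t)) + integral {0..T} (\<lambda>t. indicator {a..b} t * (e / d)\<^sup>2))"
        unfolding wsq
        by (subst integral_add[OF hk[OF v2] integrable_add[OF hk[OF indv] hk[OF ind]]],
            subst integral_add[OF hk[OF indv] hk[OF ind]]) (rule refl)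
      also have "integral {0..T} (\<lambda>t. indicator {a..b} t * (2 * e / d * v t)) = integral {a..b} (\<lambda>t. 2 * e / d * v t)"
        unfolding integral_indicator_mult cap ..
      also have "\<dots> = 2 * e / d * (r b - r a)"
        using radial_increment[OF rad, of a b] ab by simp
      also have "integral {0..T} (\<lambda>t. indicator {a..b} t * (e / d)\<^sup>2) = integral {a..b} (\<lambda>t. (e / d)\<^sup>2)"
        unfolding integral_indicator_mult cap ..
      also have "\<dots> = d * (e / d)\<^sup>2" using ab by (simp add: d_def)
      finally show ?thesis
        using d by (simp add: s_def power2_eq_square field_simps)
    qed
    have Rw: "R t = integral {0..t} w" if t: "t \<in> {0..T}" for t
    proof -
      have iv: "v integrable_on {0..t}"
        by (rule integrable_on_subinterval[OF set_borel_integral_eq_integral(1)[OF v1]]) (use t in auto)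
      have ii: "(\<lambda>t. indicator {a..b} t * (e / d)) integrable_on {0..t}"
        by (rule integrable_on_subinterval[OF set_borel_integral_eq_integral(1)[OF ind]]) (use t in auto)
      have "integral {0..t} w = integral {0..t} v + integral {0..t} (\<lambda>t. indicator {a..b} t * (e / d))"
        unfolding w_def using integral_add[OF iv ii] by (simp add: mult.commute)
      also have "integral {0..t} (\<lambda>t. indicator {a..b} t * (e / d)) = integral ({0..t} \<inter> {a..b}) (\<lambda>t. e / d)"
        by (rule integral_indicator_mult)
      also have "{0..t} \<inter> {a..b} = {a..min t b}" using ab by auto
      also have "integral {a..min t b} (\<lambda>t. e / d) = e * \<psi> t"
        using ab d by (cases "a \<le> t") (auto simp: \<psi>_def d_def)
      finally show ?thesis using radialD(4)[OF rad t] by (simp add: R_def)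
    qed
    have e\<psi>: "\<bar>e * \<psi> t\<bar> \<le> \<rho> / 2" for t
    proof -
      have "\<bar>e\<bar> * \<psi> t \<le> \<bar>e\<bar> * 1" by (intro mult_left_mono \<psi>01) auto
      then show ?thesis using e \<psi>01[of t] by (simp add: abs_mult)
    qed
    have R_ge: "1 / 2 * r t \<le> R t" if "t \<in> {0..T}" for t
    proof (cases "t \<le> a")
      case True
      then show ?thesis using r_nonneg[OF that] by (simp add: R_def \<psi>0)
    next
      case False
      then show ?thesis using r_ge[of t] e\<psi>[of t] that by (auto simp: R_def abs_le_iff)
    qed
    have R: "radial T R w"
      by (rule radialI_ge[OF rad w1 w2 Rw _ R_ge]) auto
    have pot: "integral {0..T} (\<lambda>t. 1 / R t) - integral {0..T} (\<lambda>t. 1 / r t)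
        \<le> - e * integral {a..T} (\<lambda>t. \<psi> t / (r t)\<^sup>2) + e\<^sup>2 * (2 * T / \<rho> ^ 3)"
    proof -
      note i = set_borel_integral_eq_integral(1)[OF radialD(3)[OF R]] set_borel_integral_eq_integral(1)[OF radialD(3)[OF rad]]
      have "integral {0..T} (\<lambda>t. 1 / R t) - integral {0..T} (\<lambda>t. 1 / r t) = integral {0..T} (\<lambda>t. 1 / R t - 1 / r t)"
        by (rule integral_diff[OF i, symmetric])
      also have "\<dots> = integral {a..T} (\<lambda>t. 1 / R t - 1 / r t)"
        by (rule split[OF integrable_diff[OF i]]) (simp add: R_def \<psi>0)
      also have "\<dots> \<le> integral {a..T} (\<lambda>t. - e * (\<psi> t / (r t)\<^sup>2) + e\<^sup>2 * (2 / \<rho> ^ 3))"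
      proof (rule integral_le)
        show "(\<lambda>t. 1 / R t - 1 / r t) integrable_on {a..T}"
          by (rule integrable_on_subinterval[OF integrable_diff[OF i] sub])
        show "(\<lambda>t. - e * (\<psi> t / (r t)\<^sup>2) + e\<^sup>2 * (2 / \<rho> ^ 3)) integrable_on {a..T}"
          by (intro integrable_continuous_real continuous_on_add continuous_on_mult continuous_on_const inv_cont)
        fix t assume t: "t \<in> {a..T}"
        define h where "h = e * \<psi> t"
        have rt: "\<rho> \<le> r t" by (rule r_ge[OF t])
        have Rt: "\<rho> / 2 \<le> r t + h" using rt e\<psi>[of t] by (auto simp: h_def abs_le_iff)
        have pos: "r t > 0" "r t + h > 0" using rt Rt \<rho> by auto
        \<comment> \<open>Expansion of the reciprocal with exact remainder, valid for either sign of
          h.\<close>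
        have "1 / (r t + h) - 1 / r t = - h / (r t)\<^sup>2 + h\<^sup>2 / ((r t)\<^sup>2 * (r t + h))"
        proof -
          have "1 / y - 1 / x = - (y - x) / x\<^sup>2 + (y - x)\<^sup>2 / (x\<^sup>2 * y)" if "x > 0" "y > 0" for x y :: real
            using that by (simp add: divide_simps power2_eq_square) (simp add: algebra_simps)
          from this[OF pos] show ?thesis by simp
        qed
        also have "h\<^sup>2 / ((r t)\<^sup>2 * (r t + h)) \<le> h\<^sup>2 / (\<rho>\<^sup>2 * (\<rho> / 2))"
          using rt Rt \<rho> pos by (intro divide_left_mono mult_mono power_mono) auto
        also have "\<dots> \<le> e\<^sup>2 / (\<rho>\<^sup>2 * (\<rho> / 2))"
        proof (intro divide_right_mono)
          have "h\<^sup>2 = e\<^sup>2 * (\<psi> t)\<^sup>2" by (simp add: h_def power_mult_distrib)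
          also have "\<dots> \<le> e\<^sup>2 * 1" using \<psi>01 by (intro mult_left_mono power_le_one) auto
          finally show "h\<^sup>2 \<le> e\<^sup>2" by simp
        qed (use \<rho> in auto)
        also have "\<dots> = e\<^sup>2 * (2 / \<rho> ^ 3)" by (simp add: power2_eq_square power3_eq_cube)
        finally show "1 / R t - 1 / r t \<le> - e * (\<psi> t / (r t)\<^sup>2) + e\<^sup>2 * (2 / \<rho> ^ 3)"
          by (simp add: R_def h_def)
      qed
      also have "\<dots> = integral {a..T} (\<lambda>t. - e * (\<psi> t / (r t)\<^sup>2)) + integral {a..T} (\<lambda>t. e\<^sup>2 * (2 / \<rho> ^ 3))"
        by (intro integral_add integrable_continuous_real continuous_on_mult continuous_on_const inv_cont)
      also have "integral {a..T} (\<lambda>t. - e * (\<psi> t / (r t)\<^sup>2)) = - e * integral {a..T} (\<lambda>t. \<psi> t / (r t)\<^sup>2)"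
        by (rule integral_mult_right)
      also have "integral {a..T} (\<lambda>t. e\<^sup>2 * (2 / \<rho> ^ 3)) = (T - a) * (e\<^sup>2 * (2 / \<rho> ^ 3))"
        using ab by simp
      also have "\<dots> \<le> T * (e\<^sup>2 * (2 / \<rho> ^ 3))"
        using ab \<rho> by (intro mult_right_mono) auto
      finally show ?thesis by (simp add: algebra_simps)
    qed
    have lin: "integral {0..T} R = integral {0..T} r + e * integral {0..T} \<psi>"
      unfolding R_def
      by (subst integral_add) (auto intro!: integrable_continuous_real continuous_intros r_cont \<psi>_cont)
    have "0 \<le> radial_action T R w - radial_action T r v" using minimal[OF R] by simp
    also have "\<dots> \<le> e * (s - I) + e\<^sup>2 * C"
      using pot unfolding radial_action_def kin lin I_eq C_def by (simp add: algebra_simps)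
    finally show "0 \<le> e * (s - I) + e\<^sup>2 * C" .
  qed (use \<rho> in auto)
  moreover have "I = integral {a..T} (\<lambda>t. (min t b - a) / (b - a) * g t)"
    unfolding I_def by (intro integral_cong) (use ab in \<open>auto simp: \<psi>_def d_def\<close>)
  ultimately show ?thesis by (simp add: s_def d_def)
qed

text \<open>The weight in \<open>slope_eq\<close> lies between 0 and 1 on {a..T} and equals 1 beyond
  b.\<close>

lemma slope_bounds:
  assumes ab: "0 < a" "a < b" "b \<le> T"
  shows "P b \<le> (r b - r a) / (b - a)" "(r b - r a) / (b - a) \<le> P a"
proof -
  define \<psi> where "\<psi> = (\<lambda>t. (min t b - a) / (b - a))"
  have cont: "continuous_on {a..T} (\<lambda>t. \<psi> t * g t)"
    unfolding \<psi>_def using ab by (intro continuous_intros cont_g) auto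
  have eq: "(r b - r a) / (b - a) = integral {a..T} (\<lambda>t. \<psi> t * g t)"
    unfolding \<psi>_def by (rule slope_eq[OF ab])
  have \<psi>01: "0 \<le> \<psi> t" "\<psi> t \<le> 1" if "t \<ge> a" for t using that ab by (auto simp: \<psi>_def)
  show "(r b - r a) / (b - a) \<le> P a"
    unfolding eq P_def
  proof (rule integral_le)
    show "\<psi> t * g t \<le> g t" if "t \<in> {a..T}" for t
      using mult_right_mono[OF \<psi>01(2) g_nonneg, of t] that by simp
  qed (use cont cont_g ab in \<open>auto intro: integrable_continuous_real\<close>)
  have "P b = integral {b..T} (\<lambda>t. \<psi> t * g t)"
    unfolding P_def by (intro integral_cong) (use ab in \<open>auto simp: \<psi>_def min_def\<close>)
  also have "\<dots> \<le> integral {a..b} (\<lambda>t. \<psi> t * g t) + integral {b..T} (\<lambda>t. \<psi> t * g t)"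
  proof -
    have "0 \<le> integral {a..b} (\<lambda>t. \<psi> t * g t)"
      by (intro integral_nonneg integrable_continuous_real continuous_on_subset[OF cont] mult_nonneg_nonneg g_nonneg \<psi>01)
         (use ab in auto)
    then show ?thesis by simp
  qed
  also have "\<dots> = integral {a..T} (\<lambda>t. \<psi> t * g t)"
    using ab by (intro Henstock_Kurzweil_Integration.integral_combine integrable_continuous_real cont) auto
  finally show "P b \<le> (r b - r a) / (b - a)" unfolding eq .
qed

lemma P_deriv:
  assumes x: "x \<in> {0<..T}"
  shows "(P has_real_derivative - g x) (at x within {0<..T})"
proof -
  \<comment> \<open>Integrals of g are based at d rather than 0, where g is singular.\<close>
  define d where "d = x / 2"
  have d: "0 < d" "d < x" "d \<le> T" using x by (auto simp: d_def)
  have "((\<lambda>y. integral {d..y} g) has_real_derivative g x) (at x within {d..T})"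
    using x d by (intro integral_has_real_derivative cont_g) auto
  then have D: "((\<lambda>y. integral {d..T} g - integral {d..y} g) has_real_derivative 0 - g x) (at x within {d..T})"
    by (intro DERIV_diff DERIV_const)
  have eq: "integral {d..T} g - integral {d..y} g = P y" if "y \<in> {d..T}" for y
    using Henstock_Kurzweil_Integration.integral_combine[of d y T g] that d
      integrable_continuous_real[OF cont_g[OF d(1)]] by (simp add: P_def)
  have "(P has_real_derivative 0 - g x) (at x within {d..T})"
    by (rule has_field_derivative_transform_within[OF D zero_less_one]) (use x d eq in auto)
  moreover have "at x within {d..T} = at x within {0<..T}"
    by (rule at_within_nhd[of _ "{d<..}"]) (use x d in auto)
  ultimately show ?thesis by simp
qed

text \<open>By \<open>slope_bounds\<close> the difference quotient lies between P x and P y, and P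
  is continuous. This upgrades the weak derivative v to a classical one.\<close>

lemma r_deriv:
  assumes x: "x \<in> {0<..T}"
  shows "(r has_real_derivative P x) (at x within {0<..T})"
proof -
  have bound: "norm ((r y - r x) / (y - x) - P x) \<le> norm (P y - P x)" if y: "y \<in> {0<..T}" "y \<noteq> x" for y
  proof (cases "x < y")
    case True
    then show ?thesis using slope_bounds[of x y] x y by auto
  next
    case False
    then have "y < x" using y by simp
    moreover have "(r y - r x) / (y - x) = (r x - r y) / (x - y)"
      by (metis minus_diff_eq minus_divide_divide)
    ultimately show ?thesis using slope_bounds[of y x] x y by auto
  qed
  have "(P \<longlongrightarrow> P x) (at x within {0<..T})"
    using DERIV_continuous[OF P_deriv[OF x]] by (simp add: continuous_within)
  then have "((\<lambda>y. P y - P x) \<longlongrightarrow> 0) (at x within {0<..T})" by (simp add: LIM_zero)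
  then have "((\<lambda>y. (r y - r x) / (y - x) - P x) \<longlongrightarrow> 0) (at x within {0<..T})"
    by (rule Lim_null_comparison[rotated, OF tendsto_norm_zero])
       (use bound in \<open>auto simp: eventually_at_filter\<close>)
  then show ?thesis unfolding has_field_derivative_iff by (simp add: LIM_zero_cancel)
qed

lemma P_T: "P T = 0" by (simp add: P_def)

end

section \<open>Periodic extension\<close>

lemma has_real_derivative_glue:
  fixes f g f' g' :: "real \<Rightarrow> real"
  assumes f: "\<And>x. x \<in> {a<..c} \<Longrightarrow> (f has_real_derivative f' x) (at x within {a<..c})"
    and g: "\<And>x. x \<in> {c..<b} \<Longrightarrow> (g has_real_derivative g' x) (at x within {c..<b})"
    and c: "f c = g c" "f' c = g' c" and x: "x \<in> {a<..<b}" "c \<in> {a<..<b}"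
  shows "((\<lambda>x. if x \<le> c then f x else g x) has_real_derivative (if x \<le> c then f' x else g' x)) (at x)"
proof -
  define F where "F = (\<lambda>x. if x \<le> c then f x else g x)"
  have left: "(F has_real_derivative f' x) (at x within {a<..c})" if "x \<in> {a<..c}"
    by (rule has_field_derivative_transform_within[OF f[OF that] zero_less_one]) (use that in \<open>auto simp: F_def\<close>)
  have right: "(F has_real_derivative g' x) (at x within {c..<b})" if "x \<in> {c..<b}"
    by (rule has_field_derivative_transform_within[OF g[OF that] zero_less_one]) (use that c in \<open>auto simp: F_def\<close>)
  consider "x < c" | "x = c" | "x > c" by linarith
  then have "(F has_real_derivative (if x \<le> c then f' x else g' x)) (at x)"
  proof cases
    case 1
    then have "at x within {a<..c} = at x" using x by (intro at_within_interior) simp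
    then show ?thesis using left 1 x by auto
  next
    case 2
    have "(F has_real_derivative f' c) (at c within {a<..c} \<union> {c..<b})"
      unfolding has_field_derivative_iff unfolding at_within_union
      using left[unfolded has_field_derivative_iff] right[unfolded has_field_derivative_iff] 2 x c
      by (intro filterlim_sup) auto
    moreover have "{a<..c} \<union> {c..<b} = {a<..<b}" using x by auto
    moreover have "at c within {a<..<b} = at c" using x by (intro at_within_open) auto
    ultimately show ?thesis using 2 by simp
  next
    case 3
    then have "at x within {c..<b} = at x" using x by (intro at_within_interior) simp
    then show ?thesis using right 3 x by auto
  qed
  then show ?thesis by (simp add: F_def)
qed

context radial_minimizer
begin

text \<open>Reflection in t = T, even for r and odd for P. The two halves of R' fit together because
  P T = 0.\<close>

definition R :: "real \<Rightarrow> real" where "R t = (if t \<le> T then r t else r (2 * T - t))"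
definition R' :: "real \<Rightarrow> real" where "R' t = (if t \<le> T then P t else - P (2 * T - t))"

lemma reflect_deriv:
  assumes f: "\<And>x. x \<in> {0<..T} \<Longrightarrow> (f has_real_derivative f' x) (at x within {0<..T})"
    and x: "x \<in> {T..<2 * T}"
  shows "((\<lambda>x. f (2 * T - x)) has_real_derivative - f' (2 * T - x)) (at x within {T..<2 * T})"
proof -
  have im: "(\<lambda>x. 2 * T - x) ` {T..<2 * T} = {0<..T}"
    by (auto simp: image_iff intro!: bexI[of _ "2 * T - y" for y])
  have "((\<lambda>x. 2 * T - x) has_real_derivative - 1) (at x within {T..<2 * T})"
    by (auto intro!: derivative_eq_intros)
  moreover have "(f has_real_derivative f' (2 * T - x)) (at (2 * T - x) within (\<lambda>x. 2 * T - x) ` {T..<2 * T})"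
    unfolding im using x by (intro f) auto
  ultimately have "(f \<circ> (\<lambda>x. 2 * T - x) has_real_derivative f' (2 * T - x) * - 1) (at x within {T..<2 * T})"
    by (rule DERIV_image_chain[rotated])
  then show ?thesis by (simp add: o_def)
qed

lemma R_deriv: "(R has_real_derivative R' t) (at t)" if "t \<in> {0<..<2 * T}"
  unfolding R_def[abs_def] R'_def
  by (rule has_real_derivative_glue[OF r_deriv reflect_deriv[OF r_deriv]]) (use that T_pos P_T in auto)

lemma R'_deriv: "(R' has_real_derivative - (1 / (R t)\<^sup>2 + 1)) (at t)" if "t \<in> {0<..<2 * T}"
proof -
  have "((\<lambda>x. if x \<le> T then P x else - P (2 * T - x)) has_real_derivative (if t \<le> T then - g t else - g (2 * T - t))) (at t)"
  proof (rule has_real_derivative_glue[OF P_deriv])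
    fix x assume "x \<in> {T..<2 * T}"
    from DERIV_minus[OF reflect_deriv[OF P_deriv this]]
    show "((\<lambda>x. - P (2 * T - x)) has_real_derivative - g (2 * T - x)) (at x within {T..<2 * T})"
      by simp
  qed (use that T_pos P_T in auto)
  moreover have "(if t \<le> T then - g t else - g (2 * T - t)) = - (1 / (R t)\<^sup>2 + 1)"
    by (simp add: g_def R_def)
  ultimately show ?thesis unfolding R'_def[abs_def] by simp
qed

lemma r_zero: "r 0 = 0"
  using radialD(4)[OF rad, of 0] T_pos by simp

lemma R_pos: "R t > 0" if "t \<in> {0<..<2 * T}"
  using that r_pos[of t] r_pos[of "2 * T - t"] by (auto simp: R_def)

text \<open>Triangle wave: the distance from t to the nearest multiple of 2 * T. In this form
  continuity, evenness and periodicity come from those of arccos and cos.\<close>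

definition wrap :: "real \<Rightarrow> real" where "wrap t = T / pi * arccos (cos (pi * t / T))"

lemma wrap_range: "wrap t \<in> {0..T}"
proof -
  have "0 \<le> arccos (cos (pi * t / T))" "arccos (cos (pi * t / T)) \<le> pi"
    by (auto intro!: arccos_lbound arccos_ubound)
  then show ?thesis using T_pos pi_gt_zero by (simp add: wrap_def field_simps)
qed

lemma wrap_id: "wrap t = t" if "t \<in> {0..T}"
proof -
  have "arccos (cos (pi * t / T)) = pi * t / T"
    using that T_pos by (intro arccos_cos) (auto simp: field_simps)
  then show ?thesis using T_pos by (simp add: wrap_def)
qed

lemma wrap_minus: "wrap (- t) = wrap t" by (simp add: wrap_def)

lemma wrap_shift: "wrap (t + 2 * T * of_int k) = wrap t"
proof -
  have "pi * (t + 2 * T * of_int k) / T = pi * t / T + of_int k * (2 * pi)"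
    using T_pos by (simp add: field_simps)
  moreover have "cos (x + of_int k * (2 * pi)) = cos x" for x
    using cos.plus_of_int[of x k] by simp
  ultimately show ?thesis unfolding wrap_def by (simp only:)
qed

lemma wrap_cont: "continuous_on UNIV wrap"
  unfolding wrap_def[abs_def] using T_pos by (intro continuous_intros) auto

lemma wrap_zero_iff: "wrap t = 0 \<longleftrightarrow> (\<exists>k::int. t = 2 * T * of_int k)"
proof -
  have "wrap t = 0 \<longleftrightarrow> arccos (cos (pi * t / T)) = 0" using T_pos by (simp add: wrap_def)
  also have "\<dots> \<longleftrightarrow> cos (pi * t / T) = 1"
  proof
    assume "arccos (cos (pi * t / T)) = 0"
    then have "cos (arccos (cos (pi * t / T))) = cos 0" by (simp only:)
    then show "cos (pi * t / T) = 1" by simp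
  qed simp
  also have "\<dots> \<longleftrightarrow> (\<exists>k::int. pi * t / T = of_int k * 2 * pi)" by (rule cos_one_2pi_int)
  also have "\<dots> \<longleftrightarrow> (\<exists>k::int. t = 2 * T * of_int k)"
    using T_pos by (intro arg_cong[where f=Ex] ext) (auto simp: field_simps)
  finally show ?thesis .
qed

lemma r_wrap: "r (wrap t) = R t" if "t \<in> {0..2 * T}"
proof (cases "t \<le> T")
  case True
  then show ?thesis using that by (simp add: wrap_id R_def)
next
  case False
  have "wrap t = wrap (- t + 2 * T * of_int 1)" unfolding wrap_shift wrap_minus ..
  also have "\<dots> = 2 * T - t" using that False by (subst wrap_id) auto
  finally show ?thesis using False by (simp add: R_def)
qed

text \<open>Positions are folded by \<open>wrap\<close>, but velocities change sign under
  reflection, so Q' uses the offset of t within its period instead.\<close>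

lemma periodic_extension:
  defines "Q \<equiv> \<lambda>t. (- r (wrap t), 0::real)"
  defines "Q' \<equiv> \<lambda>t. (- R' (t - 2 * T * of_int \<lfloor>t / (2 * T)\<rfloor>), 0::real)"
  shows "continuous_on UNIV Q" "Q (t + 2 * T) = Q t" "Q (- t) = Q t"
    and "Q t = 0 \<longleftrightarrow> (\<exists>k::int. t = 2 * T * of_int k)"
    and "snd (Q t) = 0 \<and> fst (Q t) \<le> 0"
    and "Q t \<noteq> 0 \<Longrightarrow> (Q has_vector_derivative Q' t) (at t) \<and> (Q' has_vector_derivative stark_field (Q t)) (at t)"
proof -
  show "continuous_on UNIV Q" unfolding Q_def
    using wrap_range by (intro continuous_intros continuous_on_compose2[OF r_cont wrap_cont]) auto
  show "Q (t + 2 * T) = Q t" using wrap_shift[of t 1] by (simp add: Q_def)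
  show "Q (- t) = Q t" by (simp add: Q_def wrap_minus)
  have "r s = 0 \<longleftrightarrow> s = 0" if "s \<in> {0..T}" for s
    using r_pos[of s] r_zero that by (cases "s = 0") auto
  then show zero: "Q t = 0 \<longleftrightarrow> (\<exists>k::int. t = 2 * T * of_int k)"
    using wrap_range[of t] by (simp add: Q_def zero_prod_def wrap_zero_iff)
  show "snd (Q t) = 0 \<and> fst (Q t) \<le> 0" using r_nonneg[OF wrap_range] by (simp add: Q_def)
  assume nz: "Q t \<noteq> 0"
  \<comment> \<open>A time without collision lies in the open period W between consecutive
    collisions, where Q and Q' are translates of R and R' up to sign.\<close>
  define k where "k = \<lfloor>t / (2 * T)\<rfloor>"
  define u where "u = t - 2 * T * of_int k"
  define W where "W = {2 * T * of_int k<..<2 * T * of_int k + 2 * T}"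
  have "of_int k \<le> t / (2 * T)" "t / (2 * T) < of_int k + 1" unfolding k_def by linarith+
  then have "2 * T * of_int k \<le> t" "t < 2 * T * of_int k + 2 * T"
    using T_pos by (simp_all add: field_simps)
  moreover have "t \<noteq> 2 * T * of_int k" using nz zero by blast
  ultimately have tW: "t \<in> W" by (simp add: W_def)
  have u: "u \<in> {0<..<2 * T}" using tW by (auto simp: W_def u_def)
  have QW: "Q s = (- R (s - 2 * T * of_int k), 0)" if "s \<in> W" for s
  proof -
    have "wrap s = wrap (s - 2 * T * of_int k)" using wrap_shift[of "s - 2 * T * of_int k" k] by simp
    then show ?thesis using that r_wrap[of "s - 2 * T * of_int k"] by (simp add: Q_def W_def)
  qed
  have Q'W: "Q' s = (- R' (s - 2 * T * of_int k), 0)" if "s \<in> W" for s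
  proof -
    have "\<lfloor>s / (2 * T)\<rfloor> = k"
      using that T_pos by (intro floor_unique) (auto simp: W_def field_simps)
    then show ?thesis by (simp add: Q'_def)
  qed
  have shift: "((\<lambda>s. (- f (s - 2 * T * of_int k), 0::real)) has_vector_derivative (- D, 0)) (at t)"
    if "(f has_real_derivative D) (at u)" for f D
  proof -
    have "((\<lambda>s. s - 2 * T * of_int k) has_real_derivative 1) (at t)"
      by (auto intro!: derivative_eq_intros)
    from DERIV_chain2[OF that[unfolded u_def] this]
    have "((\<lambda>s. - f (s - 2 * T * of_int k)) has_real_derivative - D) (at t)"
      by (auto dest: DERIV_minus)
    then show ?thesis
      unfolding has_real_derivative_iff_has_vector_derivative
      by (intro has_vector_derivative_Pair has_vector_derivative_const)
  qed
  have "(Q has_vector_derivative (- R' u, 0)) (at t)"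
    by (rule has_vector_derivative_transform_within_open[OF shift[OF R_deriv[OF u]] _ tW])
       (auto simp: QW W_def)
  moreover have "Q' t = (- R' u, 0)" using Q'W[OF tW] by (simp add: u_def)
  moreover have "(Q' has_vector_derivative (- (- (1 / (R u)\<^sup>2 + 1)), 0)) (at t)"
    by (rule has_vector_derivative_transform_within_open[OF shift[OF R'_deriv[OF u]] _ tW])
       (auto simp: Q'W W_def)
  moreover have "stark_field (Q t) = (- (- (1 / (R u)\<^sup>2 + 1)), 0)"
    using R_pos[OF u] QW[OF tW]
    by (simp add: stark_field_def u_def[symmetric] norm_Pair power2_eq_square power3_eq_cube)
  ultimately show "(Q has_vector_derivative Q' t) (at t) \<and> (Q' has_vector_derivative stark_field (Q t)) (at t)"
    by simp
qed

end

text \<open>Evenness together with the period makes every collision a time reversal, which encodes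
  the ejection along the half-line of approach.\<close>

theorem theorem1p5:
  fixes T :: real and q :: "real \<Rightarrow> real \<times> real"
  assumes "T > 0"
    and "global_minimizer T q"
  shows "\<exists>Q Q' :: real \<Rightarrow> real \<times> real.
           (\<forall>t\<in>{0..T}. Q t = q t) \<and>
           continuous_on UNIV Q \<and>
           (\<forall>t. Q (t + 2 * T) = Q t) \<and>
           (\<forall>t. Q (- t) = Q t) \<and>
           (\<forall>t. Q t = 0 \<longleftrightarrow> (\<exists>k::int. t = 2 * T * of_int k)) \<and>
           (\<forall>t. snd (Q t) = 0 \<and> fst (Q t) \<le> 0) \<and>
           (\<forall>t. Q t \<noteq> 0 \<longrightarrow>
                (Q has_vector_derivative Q' t) (at t) \<and>
                (Q' has_vector_derivative stark_field (Q t)) (at t))"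
proof -
  note axis = minimizer_on_axis[OF assms]
  obtain v where v: "H1_deriv T q v"
    using assms(2) by (auto simp: global_minimizer_def Omega_def H1_def)
  note rad = radial_of_axis_path[OF v assms(1) axis(1,3,2)]
  \<comment> \<open>A planar minimizer lying on the axis is in particular minimal among radial
    paths, each of which embeds into \<open>Omega T\<close> with the same action.\<close>
  interpret radial_minimizer T "\<lambda>t. - fst (q t)" "\<lambda>t. - fst (v t)"
  proof
    show "radial_action T (\<lambda>t. - fst (q t)) (\<lambda>t. - fst (v t)) \<le> radial_action T s w" if "radial T s w" for s w
      using minimizer_le_radial[OF assms(2) that assms(1)] rad(2) by simp
  qed (use assms(1) rad(1) in auto)
  have agree: "\<forall>t\<in>{0..T}. (- (- fst (q (wrap t))), 0) = q t"
    using axis(3) by (simp add: wrap_id prod_eq_iff)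
  show ?thesis
    by (rule exI[of _ "\<lambda>t. (- (- fst (q (wrap t))), 0)"],
        rule exI[of _ "\<lambda>t. (- R' (t - 2 * T * of_int \<lfloor>t / (2 * T)\<rfloor>), 0)"],
        rule conjI[OF agree conjI[OF periodic_extension(1)]],
        intro conjI[OF allI conjI[OF allI conjI[OF allI conjI[OF allI allI]]]] impI)
       (rule periodic_extension(2-6); assumption?)+
qed

end
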